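(* Let $G=(V,E)$ be a finite undirected graph with $n$ nodes and $m$ edges, and define $g(S)=|E(S)|^2/|S|$ for nonempty $S\subseteq V$. Let $H^{\ast}\subseteq V$ be a nonempty set maximizing $g$. Let $0<\epsilon\le 1/2$ and suppose we are given $S\subseteq V$ such that (1) $|S\cap H^{\ast}|\ge (1-\epsilon)|H^{\ast}|$, and (2) $|S\setminus H^{\ast}|\le \epsilon|H^{\ast}|$. Then there exists an $O(m)$ time algorithm that finds a subset $T\subseteq V$ with $g(T)\ge (1-3\sqrt{\epsilon})\,g(H^{\ast})$.
   Context: For $U\subseteq V$, $E(U)$ denotes the set of edges of $G$ with both endpoints in $U$. *)

theory Defs
  imports Complex_Main "HOL-Library.Landau_Symbols" "HOL-Library.Log_Nat"
begin

section \<open>Graphs and the objective function\<close>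

definition simple_graph :: "'a set \<Rightarrow> 'a set set \<Rightarrow> bool" where
  "simple_graph V E \<longleftrightarrow> finite V \<and> (\<forall>e\<in>E. e \<subseteq> V \<and> card e = 2)"

definition edges_within :: "'a set set \<Rightarrow> 'a set \<Rightarrow> 'a set set" where
  "edges_within E U = {e \<in> E. e \<subseteq> U}"

text \<open>Only used for nonempty sets; the value at the empty set is a division by zero.\<close>

definition sq_density :: "'a set set \<Rightarrow> 'a set \<Rightarrow> real" where
  "sq_density E U = (real (card (edges_within E U)))\<^sup>2 / real (card U)"


section \<open>Word RAM programs\<close>

text \<open>
  The machine has registers and a flat memory, both indexed by natural numbers. Words have
  \<open>w\<close> bits and arithmetic is modulo \<open>2 ^ w\<close>. A program is a fixed piece of syntax, so it
  mentions finitely many registers; memory is the only storage with computed addresses.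
\<close>

datatype operand = Const nat | Reg nat

datatype binop = Add | Sub | Mult | Div

datatype test = Less operand operand | Equal operand operand

datatype com =
    Skip
  | Move nat operand
  | Compute nat binop operand operand
  | Load nat operand
  | Store operand operand
  | Seq com com
  | If test com com
  | While test com

type_synonym state = "(nat \<Rightarrow> nat) \<times> (nat \<Rightarrow> nat)"

fun operand_val :: "nat \<Rightarrow> (nat \<Rightarrow> nat) \<Rightarrow> operand \<Rightarrow> nat" where
  "operand_val w r (Const k) = k mod 2 ^ w"
| "operand_val w r (Reg x) = r x"

fun binop_val :: "nat \<Rightarrow> binop \<Rightarrow> nat \<Rightarrow> nat \<Rightarrow> nat" where
  "binop_val w Add a b = (a + b) mod 2 ^ w"
| "binop_val w Sub a b = nat ((int a - int b) mod 2 ^ w)"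
| "binop_val w Mult a b = (a * b) mod 2 ^ w"
| "binop_val w Div a b = a div b"

fun test_val :: "nat \<Rightarrow> (nat \<Rightarrow> nat) \<Rightarrow> test \<Rightarrow> bool" where
  "test_val w r (Less a b) \<longleftrightarrow> operand_val w r a < operand_val w r b"
| "test_val w r (Equal a b) \<longleftrightarrow> operand_val w r a = operand_val w r b"

text \<open>
  \<open>exec w c s t s'\<close>: with word length \<open>w\<close>, program \<open>c\<close> started in \<open>s\<close> halts in \<open>s'\<close> after
  exactly \<open>t\<close> steps. Every elementary instruction and every evaluation of a test is one step.
\<close>

inductive exec :: "nat \<Rightarrow> com \<Rightarrow> state \<Rightarrow> nat \<Rightarrow> state \<Rightarrow> bool" for w :: nat where
  Skip: "exec w Skip s 1 s"
| Move: "exec w (Move x a) (r, M) 1 (r(x := operand_val w r a), M)"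
| Compute: "exec w (Compute x f a b) (r, M) 1
    (r(x := binop_val w f (operand_val w r a) (operand_val w r b)), M)"
| Load: "exec w (Load x a) (r, M) 1 (r(x := M (operand_val w r a)), M)"
| Store: "exec w (Store a b) (r, M) 1 (r, M(operand_val w r a := operand_val w r b))"
| Seq: "exec w c\<^sub>1 s t\<^sub>1 s' \<Longrightarrow> exec w c\<^sub>2 s' t\<^sub>2 s'' \<Longrightarrow> exec w (Seq c\<^sub>1 c\<^sub>2) s (t\<^sub>1 + t\<^sub>2) s''"
| If_True: "test_val w (fst s) b \<Longrightarrow> exec w c\<^sub>1 s t s' \<Longrightarrow> exec w (If b c\<^sub>1 c\<^sub>2) s (1 + t) s'"
| If_False: "\<not> test_val w (fst s) b \<Longrightarrow> exec w c\<^sub>2 s t s' \<Longrightarrow> exec w (If b c\<^sub>1 c\<^sub>2) s (1 + t) s'"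
| While_False: "\<not> test_val w (fst s) b \<Longrightarrow> exec w (While b c) s 1 s"
| While_True: "test_val w (fst s) b \<Longrightarrow> exec w c s t\<^sub>1 s' \<Longrightarrow> exec w (While b c) s' t\<^sub>2 s'' \<Longrightarrow>
    exec w (While b c) s (1 + t\<^sub>1 + t\<^sub>2) s''"

lemma exec_deterministic:
  "exec w c s t s' \<Longrightarrow> exec w c s u s'' \<Longrightarrow> t = u \<and> s' = s''"
proof (induction arbitrary: u s'' rule: exec.induct)
  case (Skip s)
  then show ?case by (cases rule: exec.cases) simp_all
next
  case (Move x a r M)
  then show ?case by (cases rule: exec.cases) simp_all
next
  case (Compute x f a b r M)
  then show ?case by (cases rule: exec.cases) simp_all
next
  case (Load x a r M)
  then show ?case by (cases rule: exec.cases) simp_all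
next
  case (Store a b r M)
  then show ?case by (cases rule: exec.cases) simp_all
next
  case (Seq c\<^sub>1 s t\<^sub>1 s1 c\<^sub>2 t\<^sub>2 s2)
  from Seq.prems obtain u\<^sub>1 s1' u\<^sub>2 where *: "u = u\<^sub>1 + u\<^sub>2"
    and 1: "exec w c\<^sub>1 s u\<^sub>1 s1'" and 2: "exec w c\<^sub>2 s1' u\<^sub>2 s''"
    by (cases rule: exec.cases) simp_all
  from Seq.IH(1)[OF 1] 2 have "t\<^sub>1 = u\<^sub>1" "exec w c\<^sub>2 s1 u\<^sub>2 s''" by simp_all
  with Seq.IH(2) * show ?case by simp
next
  case (If_True s b c\<^sub>1 t s1 c\<^sub>2)
  from If_True.prems If_True.hyps(1) obtain u\<^sub>1 where "u = 1 + u\<^sub>1" "exec w c\<^sub>1 s u\<^sub>1 s''"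
    by (cases rule: exec.cases) simp_all
  with If_True.IH show ?case by simp
next
  case (If_False s b c\<^sub>2 t s1 c\<^sub>1)
  from If_False.prems If_False.hyps(1) obtain u\<^sub>1 where "u = 1 + u\<^sub>1" "exec w c\<^sub>2 s u\<^sub>1 s''"
    by (cases rule: exec.cases) simp_all
  with If_False.IH show ?case by simp
next
  case (While_False s b c)
  from While_False.prems While_False.hyps show ?case
    by (cases rule: exec.cases) simp_all
next
  case (While_True s b c t\<^sub>1 s1 t\<^sub>2 s2)
  from While_True.prems While_True.hyps(1) obtain u\<^sub>1 s1' u\<^sub>2 where *: "u = 1 + u\<^sub>1 + u\<^sub>2"
    and 1: "exec w c s u\<^sub>1 s1'" and 2: "exec w (While b c) s1' u\<^sub>2 s''"
    by (cases rule: exec.cases) simp_all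
  from While_True.IH(1)[OF 1] 2 have "t\<^sub>1 = u\<^sub>1" "exec w (While b c) s1 u\<^sub>2 s''" by simp_all
  with While_True.IH(2) * show ?case by simp
qed


section \<open>Input and output\<close>

definition edge_list_of :: "(nat \<times> nat) list \<Rightarrow> nat set set \<Rightarrow> bool" where
  "edge_list_of es E \<longleftrightarrow>
     distinct (map (\<lambda>(u, v). {u, v}) es) \<and> set (map (\<lambda>(u, v). {u, v}) es) = E"

definition set_list_of :: "nat list \<Rightarrow> nat set \<Rightarrow> bool" where
  "set_list_of xs S \<longleftrightarrow> distinct xs \<and> set xs = S"

definition input_words :: "nat \<Rightarrow> (nat \<times> nat) list \<Rightarrow> nat list \<Rightarrow> nat list" where
  "input_words n es xs =
     [n, length es, length xs] @ concat (map (\<lambda>(u, v). [u, v]) es) @ xs"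

definition initial_state :: "nat list \<Rightarrow> state" where
  "initial_state ws = (\<lambda>_. 0, \<lambda>i. if i < length ws then ws ! i else 0)"

text \<open>The result is a block of memory cells: register 0 is its length, register 1 its start.\<close>

definition output_set :: "state \<Rightarrow> nat set" where
  "output_set s = (case s of (r, M) \<Rightarrow> M ` {r 1 ..< r 1 + r 0})"

end

theory Submission
  imports Defs
begin

text \<open>
  Writing \<open>B = H - S\<close> for the part of the optimum that \<open>S\<close> misses, optimality of \<open>H\<close> applied to \<open>B\<close> itself
  gives \<open>|E(B)| \<le> sqrt \<epsilon> |E(H)|\<close>. So \<open>S \<union> B\<close> loses few edges of \<open>H\<close> even when only the edges inside \<open>S\<close>
  and between \<open>S\<close> and \<open>B\<close> are counted, and it has at most \<open>(1 + \<epsilon>) |H|\<close> vertices. The set \<open>B\<close> is unknown,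
  but when only those edges count, the best set to add to \<open>S\<close> consists of all outside vertices with at
  least \<open>d\<close> neighbours in \<open>S\<close>, for some \<open>d\<close>. All \<open>d\<close> can be tried in \<open>O(m)\<close> steps, without knowing \<open>\<epsilon>\<close>.
  Reading \<open>S\<close> is affordable because an optimal \<open>H\<close> has no isolated vertices, so that \<open>|S| \<le> 3 m\<close>;
  in the edgeless case the program must not read \<open>S\<close> at all.
\<close>

section \<open>Extending a near-optimal set by a threshold set\<close>

text \<open>For \<open>v\<close> outside \<open>S\<close> in a simple graph this is the number of
  neighbours of \<open>v\<close> in \<open>S\<close>. Counting edges rather than neighbours turns
  the sum over outside vertices into the size of a disjoint union.\<close>

definition cross_degree :: "'a set set \<Rightarrow> 'a set \<Rightarrow> 'a \<Rightarrow> nat" where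
  "cross_degree F S v = card {e \<in> F. v \<in> e \<and> e - {v} \<subseteq> S}"

text \<open>
  A maximizer over all subsets is a superlevel set of \<open>f\<close>: at a maximal quotient \<open>x\<^sup>2 / y\<close>,
  removing a member \<open>u\<close> would help unless \<open>x < 2 y f(u)\<close>, and adding a non-member \<open>v\<close> would help
  unless \<open>2 y f(v) \<le> x\<close>.
\<close>

lemma threshold_set_maximizes_quotient:
  fixes f :: "'a \<Rightarrow> nat" and a s k :: nat
  assumes "finite X" "B \<subseteq> X" "0 < s" and bound: "\<And>v. v \<in> X \<Longrightarrow> f v \<le> k"
  shows "\<exists>d\<in>{1..Suc k}. (real (a + sum f B))\<^sup>2 / real (s + card B)
    \<le> (real (a + sum f {v\<in>X. d \<le> f v}))\<^sup>2 / real (s + card {v\<in>X. d \<le> f v})"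
proof -
  define q where "q A = (real (a + sum f A))\<^sup>2 / real (s + card A)" for A
  have "finite (q ` Pow X)" "q ` Pow X \<noteq> {}" using assms by auto
  from Max_in[OF this] obtain A where A: "A \<subseteq> X" "q A = Max (q ` Pow X)"
    by (auto simp del: Max_in)
  have opt: "q C \<le> q A" if "C \<subseteq> X" for C
    using that A(2) assms(1) by (auto intro!: Max_ge)
  have fA: "finite A" using A assms finite_subset by auto
  define x where "x = real (a + sum f A)"
  define y where "y = real (s + card A)"
  have ypos: "y > 0" using assms by (simp add: y_def)
  have "\<exists>d\<in>{1..Suc k}. q B \<le> q {v\<in>X. d \<le> f v}"
  proof (cases "x = 0 \<or> A = {}")
    case True
    \<comment> \<open>Both degenerate cases are settled by the empty set, which is the superlevel
      set at \<open>Suc k\<close>: if \<open>x = 0\<close>, the maximal quotient is 0.\<close>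
    have "{v \<in> X. Suc k \<le> f v} = {}" using bound by fastforce
    moreover have "q B \<le> q {}"
    proof (cases "A = {}")
      case True then show ?thesis using opt assms by blast
    next
      case False
      then have "q A = 0" using True by (simp add: q_def x_def)
      moreover have "0 \<le> q {}" by (simp add: q_def)
      ultimately show ?thesis using opt[OF assms(2)] by linarith
    qed
    ultimately have "q B \<le> q {v \<in> X. Suc k \<le> f v}" by (simp only:)
    then show ?thesis by (intro bexI[of _ "Suc k"]) simp_all
  next
    case False
    then have xpos: "x > 0" by (simp add: x_def del: of_nat_add of_nat_sum)
    have qA: "q A = x\<^sup>2 / y" by (simp add: q_def x_def y_def)
    have inside: "x < 2 * real (f u) * y" if u: "u \<in> A" for u
    proof -
      \<comment> \<open>\<open>0 < s\<close> together with \<open>u \<in> A\<close> gives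
        \<open>y > 1\<close>, so the denominator \<open>y - 1\<close> left after removing
        \<open>u\<close> is still positive.\<close>
      have "card A \<ge> 1" using u fA by (metis One_nat_def Suc_leI card_gt_0_iff empty_iff)
      then have 1: "real (s + card (A - {u})) = y - 1" and y1: "y > 1"
        using u fA assms by (auto simp: y_def of_nat_diff)
      have 2: "real (a + sum f (A - {u})) = x - f u"
        using u fA by (simp add: x_def sum.remove)
      have "q (A - {u}) \<le> q A" using opt A by blast
      then have "(x - f u)\<^sup>2 / (y - 1) \<le> x\<^sup>2 / y"
        unfolding q_def 1 2 qA[unfolded q_def] by (simp add: x_def y_def)
      then have *: "(x - f u)\<^sup>2 * y \<le> x\<^sup>2 * (y - 1)"
        using y1 by (simp add: field_simps)
      then have **: "x * x + real (f u) * real (f u) * y \<le> x * (2 * real (f u) * y)"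
        by (simp add: power2_eq_square algebra_simps)
      \<comment> \<open>The term \<open>f u * f u * y\<close> must be strictly positive:
        \<open>inside\<close> has to be strict so that members and non-members are
        separated.\<close>
      have "f u \<noteq> 0"
      proof
        assume "f u = 0"
        with ** have "x * x \<le> 0" by simp
        with mult_pos_pos[OF xpos xpos] show False by linarith
      qed
      then have "0 < real (f u) * real (f u) * y" using ypos by simp
      with ** have "x * x < x * (2 * real (f u) * y)" by linarith
      then show ?thesis using xpos by simp
    qed
    have outside: "2 * real (f v) * y \<le> x" if v: "v \<in> X - A" for v
    proof -
      have 1: "real (s + card (insert v A)) = y + 1" using v fA by (simp add: y_def)
      have 2: "real (a + sum f (insert v A)) = x + f v" using v fA by (simp add: x_def)
      have "q (insert v A) \<le> q A" using opt A v by blast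
      then have "(x + f v)\<^sup>2 / (y + 1) \<le> x\<^sup>2 / y"
        unfolding q_def 1 2 by (simp add: x_def y_def)
      then have "(x + f v)\<^sup>2 * y \<le> x\<^sup>2 * (y + 1)"
        using ypos by (simp add: field_simps)
      then have "x * (2 * real (f v) * y) + real (f v) * real (f v) * y \<le> x * x"
        by (simp add: power2_eq_square algebra_simps)
      moreover have "0 \<le> real (f v) * real (f v) * y" using ypos by simp
      ultimately have "x * (2 * real (f v) * y) \<le> x * x" by linarith
      then show ?thesis using xpos by simp
    qed
    have sep: "f v < f u" if "u \<in> A" "v \<in> X - A" for u v
    proof -
      have "2 * real (f v) * y < 2 * real (f u) * y"
        using inside[OF that(1)] outside[OF that(2)] by linarith
      then show ?thesis using ypos by simp
    qed
    define d where "d = Min (f ` A)"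
    have dA: "d \<in> f ` A" using False fA by (simp add: d_def)
    then obtain u where u: "u \<in> A" "d = f u" by auto
    have "d \<le> f v" if "v \<in> A" for v using that fA by (simp add: d_def)
    then have "A = {v \<in> X. d \<le> f v}" using A(1) sep u by fastforce
    moreover have "d \<noteq> 0" using inside[OF u(1)] u(2) xpos by (cases "f u = 0") auto
    moreover have "d \<le> k" using u A bound by auto
    ultimately show ?thesis using opt[OF assms(2)] by (intro bexI[of _ d]) auto
  qed
  then show ?thesis by (simp add: q_def)
qed

text \<open>A value \<open>f v \<ge> d\<close> is \<open>d\<close> plus one for every
  \<open>j\<close> in \<open>{Suc d..k}\<close> with \<open>j \<le> f v\<close>; exchanging the sums
  leaves sizes of superlevel sets. The level counts alone thus suffice to evaluate every
  threshold.\<close>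

lemma sum_superlevel_layers:
  fixes f :: "'a \<Rightarrow> nat"
  assumes "finite X" and "\<And>v. v \<in> X \<Longrightarrow> f v \<le> k"
  shows "sum f {v\<in>X. d \<le> f v} =
    d * card {v\<in>X. d \<le> f v} + (\<Sum>j=Suc d..k. card {v\<in>X. j \<le> f v})"
proof -
  let ?A = "{v\<in>X. d \<le> f v}"
  have "f v = d + (\<Sum>j=Suc d..k. if j \<le> f v then 1 else 0)" if "v \<in> ?A" for v
  proof -
    have "{j \<in> {Suc d..k}. j \<le> f v} = {Suc d..f v}" using that assms(2)[of v] by auto
    then show ?thesis using that by (simp add: sum.If_cases Int_def)
  qed
  then have "sum f ?A = (\<Sum>v\<in>?A. d + (\<Sum>j=Suc d..k. if j \<le> f v then 1 else 0))"
    by (rule sum.cong[OF refl])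
  also have "\<dots> = d * card ?A + (\<Sum>j=Suc d..k. \<Sum>v\<in>?A. if j \<le> f v then 1 else 0)"
    unfolding sum.distrib by (subst sum.swap) simp
  also have "(\<Sum>j=Suc d..k. \<Sum>v\<in>?A. if j \<le> f v then 1 else 0)
      = (\<Sum>j=Suc d..k. card {v\<in>X. j \<le> f v})"
  proof (rule sum.cong[OF refl])
    fix j assume "j \<in> {Suc d..k}"
    then have "?A \<inter> {v. j \<le> f v} = {v\<in>X. j \<le> f v}" by auto
    then show "(\<Sum>v\<in>?A. if j \<le> f v then 1 else 0) = card {v\<in>X. j \<le> f v}"
      using assms(1) by (simp add: sum.If_cases)
  qed
  finally show ?thesis .
qed

section \<open>Edges captured by adding vertices to \<open>S\<close>\<close>

lemma finite_edges: "simple_graph V E \<Longrightarrow> finite E"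
  by (auto simp: simple_graph_def intro: finite_subset[of E "Pow V"])

text \<open>An edge counted at \<open>v\<close> has no endpoint outside \<open>S\<close> other than
  \<open>v\<close>, so different vertices of \<open>A\<close> count different edges.\<close>

lemma sum_cross_degree:
  assumes "finite E" "finite A" "A \<inter> S = {}"
  shows "(\<Sum>v\<in>A. cross_degree E S v) = card (\<Union>v\<in>A. {e \<in> E. v \<in> e \<and> e - {v} \<subseteq> S})"
  unfolding cross_degree_def using assms by (intro card_UN_disjoint[symmetric]) auto

text \<open>Edges inside \<open>A\<close> are left out of the left side; ignoring them makes the
  contribution of \<open>A\<close> additive over its vertices.\<close>

lemma captured_edges_le:
  assumes "finite E" "finite A" "A \<inter> S = {}"
  shows "card (edges_within E S) + (\<Sum>v\<in>A. cross_degree E S v)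
    \<le> card (edges_within E (S \<union> A))"
proof -
  let ?U = "\<Union>v\<in>A. {e \<in> E. v \<in> e \<and> e - {v} \<subseteq> S}"
  have "card (edges_within E S) + card ?U = card (edges_within E S \<union> ?U)"
    using assms by (intro card_Un_disjoint[symmetric]) (auto simp: edges_within_def)
  also have "\<dots> \<le> card (edges_within E (S \<union> A))"
    using assms by (intro card_mono) (auto simp: edges_within_def)
  finally show ?thesis using sum_cross_degree[OF assms] by simp
qed

text \<open>The three terms account for the edges of \<open>H\<close> with none, one or two
  endpoints outside \<open>S\<close>.\<close>

lemma edges_within_le_captured:
  assumes "simple_graph V E" "finite H"
  shows "card (edges_within E H) \<le> card (edges_within E S)
    + (\<Sum>v\<in>H - S. cross_degree E S v) + card (edges_within E (H - S))"
proof -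
  let ?U = "\<Union>v\<in>H - S. {e \<in> E. v \<in> e \<and> e - {v} \<subseteq> S}"
  have "edges_within E H \<subseteq> edges_within E S \<union> ?U \<union> edges_within E (H - S)"
  proof
    fix e assume "e \<in> edges_within E H"
    then have e: "e \<in> E" "e \<subseteq> H" by (auto simp: edges_within_def)
    then obtain a b where "e = {a, b}" using assms by (auto simp: simple_graph_def card_2_iff)
    with e show "e \<in> edges_within E S \<union> ?U \<union> edges_within E (H - S)"
      by (cases "a \<in> S"; cases "b \<in> S") (auto simp: edges_within_def)
  qed
  moreover have fE: "finite E" using assms finite_edges by blast
  ultimately have "card (edges_within E H) \<le> card (edges_within E S \<union> ?U \<union> edges_within E (H - S))"
    using assms(2) by (intro card_mono) (auto simp: edges_within_def)
  also have "\<dots> \<le> card (edges_within E S) + card ?U + card (edges_within E (H - S))"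
    by (meson add_le_mono1 card_Un_le le_trans)
  also have "card ?U = (\<Sum>v\<in>H - S. cross_degree E S v)"
    using sum_cross_degree[of E "H - S" S] fE assms by (simp add: Diff_Int_distrib2)
  finally show ?thesis .
qed

text \<open>With \<open>\<sigma> = sqrt \<epsilon>\<close>, the numerator base is at least
  \<open>(1 - \<sigma>) |E(H)|\<close> and the denominator at most
  \<open>(1 + \<sigma>\<^sup>2) |H|\<close>; the claim then follows from \<open>(1 - 3 \<sigma>) (1
  + \<sigma>\<^sup>2) \<le> (1 - \<sigma>)\<^sup>2\<close>.\<close>

lemma near_optimal_extension:
  assumes G: "simple_graph V E"
    and opt: "is_arg_max (sq_density E) (\<lambda>U. U \<subseteq> V \<and> U \<noteq> {}) H"
    and eps: "0 < \<epsilon>" "\<epsilon> \<le> 1 / 2" and SV: "S \<subseteq> V"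
    and hit: "real (card (S \<inter> H)) \<ge> (1 - \<epsilon>) * real (card H)"
    and miss: "real (card (S - H)) \<le> \<epsilon> * real (card H)"
  shows "(1 - 3 * sqrt \<epsilon>) * sq_density E H \<le>
    (real (card (edges_within E S) + (\<Sum>v\<in>H - S. cross_degree E S v)))\<^sup>2
      / real (card S + card (H - S))" (is "_ \<le> ?x\<^sup>2 / ?y")
proof (cases "sqrt \<epsilon> \<ge> 1 / 3")
  case True
  \<comment> \<open>Here the left side is nonpositive. The other case multiplies an inequality by
    \<open>1 - 3 * \<sigma>\<close>, which must be positive there.\<close>
  have "(1 - 3 * sqrt \<epsilon>) * sq_density E H \<le> 0"
    using True by (intro mult_nonpos_nonneg) (auto simp: sq_density_def)
  also have "0 \<le> ?x\<^sup>2 / ?y" by simp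
  finally show ?thesis .
next
  case False
  define \<sigma> where "\<sigma> = sqrt \<epsilon>"
  have \<sigma>: "0 < \<sigma>" "\<sigma> < 1 / 3" "\<epsilon> = \<sigma>\<^sup>2" using eps False by (auto simp: \<sigma>_def)
  have HV: "H \<subseteq> V" "H \<noteq> {}"
    and best: "\<And>U. U \<subseteq> V \<Longrightarrow> U \<noteq> {} \<Longrightarrow> sq_density E U \<le> sq_density E H"
    using opt unfolding is_arg_max_def by (auto simp: not_less)
  have fin: "finite V" "finite H" "finite S"
    using G finite_subset[OF HV(1)] finite_subset[OF SV] by (auto simp: simple_graph_def)
  define h where "h = real (card H)"
  define e where "e = real (card (edges_within E H))"
  define b where "b = real (card (edges_within E (H - S)))"
  have hpos: "h > 0" using HV fin by (simp add: h_def card_gt_0_iff)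
  have "card H = card (S \<inter> H) + card (H - S)"
    using card_Int_Diff[of H S] fin by (simp add: Int_commute)
  then have out: "real (card (H - S)) \<le> \<epsilon> * h" using hit by (simp add: h_def algebra_simps)
  \<comment> \<open>Both sides equal \<open>card (S \<union> H)\<close>; this bounds the denominator
    from above and from below.\<close>
  have "card S + card (H - S) = card H + card (S - H)"
    using card_Un_disjoint[of S "H - S"] card_Un_disjoint[of H "S - H"] fin
    by (simp add: Un_commute)
  then have y: "?y \<le> (1 + \<epsilon>) * h" using miss by (simp add: h_def algebra_simps)
  have ypos: "?y > 0"
  proof -
    have "card S + card (H - S) \<ge> card H"
      using \<open>card S + card (H - S) = card H + card (S - H)\<close> by simp
    then show ?thesis using hpos by (simp add: h_def)
  qed
  \<comment> \<open>If nonempty, \<open>H - S\<close> competes with \<open>H\<close> and has at most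
    \<open>\<epsilon> * h\<close> vertices. The empty set is no competitor, but it contains no edge
    because edges have two elements.\<close>
  have "b \<le> \<sigma> * e"
  proof (cases "H - S = {}")
    case True
    have "edges_within E {} = {}"
      using G by (auto simp: edges_within_def simple_graph_def)
    with True have "edges_within E (H - S) = {}" by (simp only:)
    then show ?thesis using \<sigma> by (simp add: b_def e_def)
  next
    case False
    then have B: "0 < real (card (H - S))" using fin by (simp add: card_gt_0_iff)
    have "b\<^sup>2 / real (card (H - S)) \<le> e\<^sup>2 / h"
      using best[of "H - S"] False HV by (auto simp: sq_density_def b_def e_def h_def)
    then have "b\<^sup>2 \<le> e\<^sup>2 / h * real (card (H - S))" using B by (simp add: field_simps)
    also have "\<dots> \<le> e\<^sup>2 / h * (\<epsilon> * h)" using out hpos by (intro mult_left_mono) auto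
    also have "\<dots> = (\<sigma> * e)\<^sup>2" using hpos \<sigma> by (simp add: power_mult_distrib)
    finally show ?thesis by (rule power2_le_imp_le) (use \<sigma> in \<open>simp add: e_def\<close>)
  qed
  moreover have "e \<le> ?x + b"
    using edges_within_le_captured[OF G fin(2), of S] unfolding e_def b_def by linarith
  ultimately have x: "(1 - \<sigma>) * e \<le> ?x" by (simp add: algebra_simps)
  have "(1 - 3 * \<sigma>) * ((1 + \<epsilon>) * h) \<le> (1 - \<sigma>)\<^sup>2 * h"
  proof -
    \<comment> \<open>This is the right side minus the left side of the claim.\<close>
    have "0 \<le> (\<sigma> + 3 * \<sigma> * \<sigma>\<^sup>2) * h" using \<sigma> hpos by simp
    then show ?thesis unfolding \<sigma>(3) by (simp add: power2_eq_square algebra_simps)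
  qed
  then have "(1 - 3 * \<sigma>) * ?y \<le> (1 - \<sigma>)\<^sup>2 * h"
    using mult_left_mono[OF y, of "1 - 3 * \<sigma>"] \<sigma> by linarith
  then have "(1 - 3 * \<sigma>) * ?y * (e\<^sup>2 / h) \<le> (1 - \<sigma>)\<^sup>2 * h * (e\<^sup>2 / h)"
    using hpos by (intro mult_right_mono) auto
  also have "\<dots> = ((1 - \<sigma>) * e)\<^sup>2" using hpos by (simp add: power_mult_distrib)
  also have "\<dots> \<le> ?x\<^sup>2" using x \<sigma> by (intro power_mono) (auto simp: e_def)
  finally have "(1 - 3 * \<sigma>) * (e\<^sup>2 / h) \<le> ?x\<^sup>2 / ?y" using ypos
    by (simp add: pos_le_divide_eq mult_ac)
  then show ?thesis by (simp add: sq_density_def \<sigma>_def e_def h_def)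
qed

text \<open>A single edge has positive density, so \<open>H\<close> contains an edge. Deleting the
  vertices isolated within \<open>H\<close> would keep all its edges, so by optimality there are
  none and the edges of \<open>H\<close> cover it. This bound makes reading \<open>S\<close> linear
  in \<open>m\<close>.\<close>

lemma optimal_card_le_twice_edges:
  assumes G: "simple_graph V E" and "E \<noteq> {}"
    and opt: "is_arg_max (sq_density E) (\<lambda>U. U \<subseteq> V \<and> U \<noteq> {}) H"
  shows "card H \<le> 2 * card E"
proof -
  have HV: "H \<subseteq> V" "H \<noteq> {}"
    and best: "\<And>U. U \<subseteq> V \<Longrightarrow> U \<noteq> {} \<Longrightarrow> sq_density E U \<le> sq_density E H"
    using opt unfolding is_arg_max_def by (auto simp: not_less)
  have fin: "finite V" "finite H" "finite E"
    using G finite_subset[OF HV(1)] finite_edges[OF G] by (auto simp: simple_graph_def)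
  let ?F = "edges_within E H"
  obtain d where d: "d \<in> E" using assms by blast
  then have d2: "d \<subseteq> V" "card d = 2" using G by (auto simp: simple_graph_def)
  have "d \<in> edges_within E d" using d by (simp add: edges_within_def)
  then have "card (edges_within E d) > 0" using fin by (auto simp: card_gt_0_iff edges_within_def)
  then have "sq_density E d > 0" using d2 by (simp add: sq_density_def)
  moreover have "sq_density E d \<le> sq_density E H" using best[OF d2(1)] d2(2) by fastforce
  ultimately have pos: "card ?F > 0" by (cases "card ?F = 0") (auto simp: sq_density_def)
  let ?W = "\<Union>?F"
  have card2: "card e = 2" if "e \<in> ?F" for e
    using that G by (auto simp: edges_within_def simple_graph_def)
  have WH: "?W \<subseteq> H" by (auto simp: edges_within_def)
  have W0: "?W \<noteq> {}"
  proof -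
    obtain e where "e \<in> ?F" using pos by (auto simp: card_gt_0_iff)
    moreover from this have "e \<noteq> {}" using card2 by force
    ultimately show ?thesis by blast
  qed
  have eq: "edges_within E ?W = ?F" using WH by (auto simp: edges_within_def)
  have Wpos: "card ?W > 0" using W0 finite_subset[OF WH] fin unfolding card_gt_0_iff by blast
  have Hpos: "card H > 0" using HV fin by (simp add: card_gt_0_iff)
  have "sq_density E ?W \<le> sq_density E H" using best WH HV W0 by blast
  then have "(real (card ?F))\<^sup>2 / real (card ?W) \<le> (real (card ?F))\<^sup>2 / real (card H)"
    by (simp only: sq_density_def eq)
  then have "card H \<le> card ?W" using pos Wpos Hpos by (simp add: field_simps)
  also have "\<dots> \<le> (\<Sum>e\<in>?F. card e)" by (rule card_Union_le_sum_card)
  also have "\<dots> = 2 * card ?F" using card2 by simp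
  also have "\<dots> \<le> 2 * card E" using fin by (simp add: edges_within_def card_mono)
  finally show ?thesis .
qed

section \<open>Weakest preconditions for timed execution\<close>

text \<open>Total correctness: halting is part of the claim. The step count is an argument of the
  postcondition, so time and result are established together.\<close>

definition runs :: "nat \<Rightarrow> com \<Rightarrow> state \<Rightarrow> (nat \<Rightarrow> state \<Rightarrow> bool) \<Rightarrow> bool" where
  "runs w c s Q \<longleftrightarrow> (\<exists>t s'. exec w c s t s' \<and> Q t s')"

text \<open>The closing \<open>Skip\<close> costs a step, so a block of \<open>k\<close> elementary
  instructions takes \<open>k + 1\<close> steps.\<close>

primrec block :: "com list \<Rightarrow> com" where
  "block [] = Skip"
| "block (c # cs) = Seq c (block cs)"

text \<open>By determinism one known execution decides every postcondition; as equivalences, the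
  instances let the simplifier run straight-line code symbolically.\<close>

lemma runs_exec_iff: "exec w c s t s' \<Longrightarrow> runs w c s Q \<longleftrightarrow> Q t s'"
  unfolding runs_def using exec_deterministic by blast

lemmas runs_basic [simp] =
  runs_exec_iff[OF exec.Skip] runs_exec_iff[OF exec.Move] runs_exec_iff[OF exec.Compute]
  runs_exec_iff[OF exec.Load] runs_exec_iff[OF exec.Store]

lemma runs_Seq [simp]:
  "runs w (Seq c1 c2) s Q \<longleftrightarrow> runs w c1 s (\<lambda>t s'. runs w c2 s' (\<lambda>t' s''. Q (t + t') s''))"
proof
  assume "runs w (Seq c1 c2) s Q"
  then obtain t s' where "exec w (Seq c1 c2) s t s'" "Q t s'" unfolding runs_def by blast
  then show "runs w c1 s (\<lambda>t s'. runs w c2 s' (\<lambda>t' s''. Q (t + t') s''))"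
    unfolding runs_def by (cases rule: exec.cases) (blast | simp)
qed (unfold runs_def, blast intro: exec.Seq)

lemma runs_If [simp]:
  "runs w (If b c1 c2) s Q \<longleftrightarrow>
    (if test_val w (fst s) b then runs w c1 s (\<lambda>t s'. Q (1 + t) s')
     else runs w c2 s (\<lambda>t s'. Q (1 + t) s'))"
proof
  assume "runs w (If b c1 c2) s Q"
  then obtain t s' where "exec w (If b c1 c2) s t s'" "Q t s'" unfolding runs_def by blast
  then show "if test_val w (fst s) b then runs w c1 s (\<lambda>t s'. Q (1 + t) s')
     else runs w c2 s (\<lambda>t s'. Q (1 + t) s')"
    unfolding runs_def by (cases rule: exec.cases) (auto simp del: split_paired_Ex)
qed (unfold runs_def, metis exec.If_True exec.If_False)

lemma runs_mono: "runs w c s Q \<Longrightarrow> (\<And>t s'. Q t s' \<Longrightarrow> Q' t s') \<Longrightarrow> runs w c s Q'"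
  unfolding runs_def by blast

text \<open>The index of \<open>I\<close> counts completed iterations, and \<open>N\<close> is their
  exact number. An iteration costs its test and at most \<open>K\<close> steps; the final
  \<open>+ 1\<close> is the failing test.\<close>

lemma runs_While:
  assumes start: "I 0 s"
    and step: "\<And>i s. i < N \<Longrightarrow> I i s \<Longrightarrow>
      test_val w (fst s) b \<and> runs w c s (\<lambda>t s'. t \<le> K \<and> I (Suc i) s')"
    and stop: "\<And>s. I N s \<Longrightarrow> \<not> test_val w (fst s) b"
  shows "runs w (While b c) s (\<lambda>t s'. t \<le> N * (K + 1) + 1 \<and> I N s')"
proof -
  \<comment> \<open>Induction on the number \<open>k\<close> of iterations still to come.\<close>
  have "runs w (While b c) s (\<lambda>t s'. t \<le> k * (K + 1) + 1 \<and> I N s')" if "I (N - k) s" "k \<le> N" for k s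
    using that
  proof (induction k arbitrary: s)
    case 0
    then have "exec w (While b c) s 1 s" using stop[of s] by (intro exec.While_False) simp
    then show ?case using 0 unfolding runs_def by fastforce
  next
    case (Suc k)
    have "N - Suc k < N" using Suc.prems by simp
    from step[OF this Suc.prems(1)] obtain t s' where t: "test_val w (fst s) b" "exec w c s t s'"
      "t \<le> K" "I (Suc (N - Suc k)) s'" unfolding runs_def by blast
    have "Suc (N - Suc k) = N - k" using Suc.prems by simp
    with t Suc.IH[of s'] Suc.prems obtain u s'' where "exec w (While b c) s' u s''"
      "u \<le> k * (K + 1) + 1" "I N s''" unfolding runs_def by auto
    with exec.While_True[OF t(1,2)] t(3) show ?case unfolding runs_def
      by (intro exI[of _ "1 + t + u"] exI[of _ s'']) simp
  qed
  from this[of N s] start show ?thesis by simp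
qed

lemma runs_timed_Seq:
  assumes "runs w c1 s (\<lambda>t s'. t \<le> T1 \<and> P s')"
    and "\<And>s'. P s' \<Longrightarrow> runs w c2 s' (\<lambda>t s'. t \<le> T2 \<and> Q s')"
  shows "runs w (Seq c1 c2) s (\<lambda>t s'. t \<le> T1 + T2 \<and> Q s')"
  unfolding runs_Seq
proof (rule runs_mono[OF assms(1)])
  fix t s' assume *: "t \<le> T1 \<and> P s'"
  show "runs w c2 s' (\<lambda>t' s''. t + t' \<le> T1 + T2 \<and> Q s'')"
    by (rule runs_mono[OF assms(2)]) (use * in auto)
qed

section \<open>The program\<close>

text \<open>
  Registers: 1 start of the output block, 2 \<open>n\<close>, 3 \<open>m\<close>, 4 \<open>|S|\<close>, 5 base of the degree array,
  6 base of the level array, 7 read pointer, 8 number of edges inside \<open>S\<close>, 9 running sum of levels,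
  10 end of the input; 11, 12, 13 numerator base, denominator and threshold of the best candidate
  so far; 14 current threshold; from 15 on scratch.

  The output block starts at the copy of \<open>S\<close> in the input, so that \<open>S\<close> need not be copied, and grows
  into the \<open>2 m\<close> free cells behind it; repeated vertices are harmless. Behind them come the degree
  array, which holds the impossible degree \<open>m + 1\<close> for the members of \<open>S\<close>, and the level array, whose
  cell \<open>j\<close> counts the vertices outside \<open>S\<close> with at least \<open>j\<close> neighbours in \<open>S\<close>. Both rely on memory
  being zero initially: clearing \<open>n\<close> cells would not be linear in \<open>m\<close>.
\<close>

definition setup_prog :: com where
  "setup_prog = block [
    Load 2 (Const 0), Load 4 (Const 2),
    Compute 1 Mult (Const 2) (Reg 3), Compute 1 Add (Reg 1) (Const 3),
    Compute 10 Add (Reg 1) (Reg 4),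
    Compute 5 Mult (Const 2) (Reg 3), Compute 5 Add (Reg 10) (Reg 5),
    Compute 6 Add (Reg 5) (Reg 2),
    Compute 13 Add (Reg 3) (Const 1),
    Move 7 (Reg 1)]"

text \<open>Register 13 serves twice: its initial value \<open>m + 1\<close> is the mark stored for
  members of \<open>S\<close>, and later the starting threshold, which selects no vertex.\<close>

definition mark_body :: com where
  "mark_body = block [
    Load 15 (Reg 7), Compute 15 Add (Reg 5) (Reg 15), Store (Reg 15) (Reg 13),
    Compute 7 Add (Reg 7) (Const 1)]"

text \<open>
  A degree rising to \<open>c\<close> adds one vertex to level \<open>c\<close> only, so the levels are maintained in constant
  time per edge and no sorting is needed.
\<close>

definition bump_prog :: "nat \<Rightarrow> nat \<Rightarrow> com" where
  "bump_prog a c = block [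
    Compute c Add (Reg c) (Const 1), Store (Reg a) (Reg c),
    Compute 21 Add (Reg 6) (Reg c), Load 22 (Reg 21), Compute 22 Add (Reg 22) (Const 1),
    Store (Reg 21) (Reg 22)]"

text \<open>A degree cell above \<open>m\<close> identifies a member of \<open>S\<close>, since true
  degrees are at most \<open>m\<close>. Only an edge with exactly one endpoint in \<open>S\<close>
  changes the arrays.\<close>

definition edge_body :: com where
  "edge_body = block [
    Load 15 (Reg 7), Compute 16 Add (Reg 7) (Const 1), Load 16 (Reg 16),
    Compute 17 Add (Reg 5) (Reg 15), Compute 18 Add (Reg 5) (Reg 16),
    Load 19 (Reg 17), Load 20 (Reg 18),
    If (Less (Reg 3) (Reg 19))
      (If (Less (Reg 3) (Reg 20)) (Compute 8 Add (Reg 8) (Const 1)) (bump_prog 18 20))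
      (If (Less (Reg 3) (Reg 20)) (bump_prog 17 19) Skip),
    Compute 7 Add (Reg 7) (Const 2)]"

text \<open>Thresholds run from \<open>m\<close> down to 1, so register 9 already holds the sum of
  all higher levels. Quotients are compared by cross-multiplication; on a tie the larger threshold
  stays.\<close>

definition threshold_body :: com where
  "threshold_body = block [
    Compute 15 Add (Reg 6) (Reg 14), Load 15 (Reg 15),
    Compute 16 Mult (Reg 14) (Reg 15), Compute 16 Add (Reg 16) (Reg 9),
    Compute 16 Add (Reg 16) (Reg 8),
    Compute 17 Add (Reg 4) (Reg 15),
    Compute 18 Mult (Reg 16) (Reg 16), Compute 18 Mult (Reg 18) (Reg 12),
    Compute 19 Mult (Reg 11) (Reg 11), Compute 19 Mult (Reg 19) (Reg 17),
    If (Less (Reg 19) (Reg 18))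
      (block [Move 11 (Reg 16), Move 12 (Reg 17), Move 13 (Reg 14)]) Skip,
    Compute 9 Add (Reg 9) (Reg 15),
    Compute 14 Sub (Reg 14) (Const 1)]"

text \<open>Scanning the edge list instead of all \<open>n\<close> vertices keeps this phase linear
  in \<open>m\<close>; as thresholds are at least 1, every vertex to be added occurs there.\<close>

definition output_body :: com where
  "output_body = block [
    Load 15 (Reg 7), Compute 16 Add (Reg 5) (Reg 15), Load 16 (Reg 16),
    If (Less (Reg 16) (Reg 13)) Skip
      (block [Compute 17 Add (Reg 1) (Reg 0), Store (Reg 17) (Reg 15),
        Compute 0 Add (Reg 0) (Const 1)]),
    Compute 7 Add (Reg 7) (Const 1)]"

definition nonempty_prog :: com where
  "nonempty_prog = block [
    setup_prog,
    While (Less (Reg 7) (Reg 10)) mark_body,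
    block [Move 7 (Const 3), Move 8 (Const 0)],
    While (Less (Reg 7) (Reg 1)) edge_body,
    block [Move 9 (Const 0), Move 11 (Reg 8), Move 12 (Reg 4), Move 14 (Reg 3)],
    While (Less (Const 0) (Reg 14)) threshold_body,
    block [Move 0 (Reg 4), Move 7 (Const 3)],
    While (Less (Reg 7) (Reg 1)) output_body]"

text \<open>Without edges the output block is cell 1 alone. It holds \<open>m = 0\<close>, so the
  result is the vertex 0, as good as any set because all densities vanish.\<close>

definition refine_prog :: com where
  "refine_prog = block [
    Load 3 (Const 1),
    If (Equal (Reg 3) (Const 0)) (block [Move 0 (Const 1), Move 1 (Const 1)]) nonempty_prog]"

section \<open>Degree updates and overflow-free arithmetic\<close>

lemma cross_degree_insert:
  assumes "finite F" "e \<notin> F"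
  shows "cross_degree (insert e F) S x
    = cross_degree F S x + (if x \<in> e \<and> e - {x} \<subseteq> S then 1 else 0)"
proof -
  let ?P = "\<lambda>d. x \<in> d \<and> d - {x} \<subseteq> S"
  have "{d \<in> insert e F. ?P d} = (if ?P e then insert e {d \<in> F. ?P d} else {d \<in> F. ?P d})"
    by auto
  then show ?thesis using assms unfolding cross_degree_def by simp
qed

lemma cross_degree_le: "finite F \<Longrightarrow> cross_degree F S v \<le> card F"
  unfolding cross_degree_def by (intro card_mono) auto

lemma card_superlevel_increment:
  fixes f :: "'a \<Rightarrow> nat"
  assumes "finite X" "v \<in> X"
  shows "card {x\<in>X. j \<le> (f(v := Suc (f v))) x}
    = card {x\<in>X. j \<le> f x} + (if j = Suc (f v) then 1 else 0)"
proof (cases "j = Suc (f v)")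
  case True
  then have "{x\<in>X. j \<le> (f(v := Suc (f v))) x} = insert v {x\<in>X. j \<le> f x}"
    using assms by auto
  then show ?thesis using assms True by simp
next
  case False
  then have "{x\<in>X. j \<le> (f(v := Suc (f v))) x} = {x\<in>X. j \<le> f x}"
    using assms by auto
  then show ?thesis using False by simp
qed

lemma length_flatten_pairs: "length (concat (map (\<lambda>(u, v). [u, v]) es)) = 2 * length es"
  by (induction es) auto

lemma nth_flatten_pairs:
  "i < length es \<Longrightarrow> concat (map (\<lambda>(u, v). [u, v]) es) ! (2 * i) = fst (es ! i)"
  "i < length es \<Longrightarrow> concat (map (\<lambda>(u, v). [u, v]) es) ! (Suc (2 * i)) = snd (es ! i)"
  by (induction es arbitrary: i) (auto simp: nth_Cons split: nat.splits)

lemma binop_val_exact: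
  "a + b < 2 ^ w \<Longrightarrow> binop_val w Add a b = a + b"
  "a * b < 2 ^ w \<Longrightarrow> binop_val w Mult a b = a * b"
  "b \<le> a \<Longrightarrow> a < 2 ^ w \<Longrightarrow> binop_val w Sub a b = a - b"
  "k < 2 ^ w \<Longrightarrow> operand_val w r (Const k) = k"
proof -
  assume *: "b \<le> a" "a < 2 ^ w"
  then have "int a < 2 ^ w" by (metis of_nat_less_iff of_nat_numeral of_nat_power)
  then have "(int a - int b) mod 2 ^ w = int a - int b" 
    using *(1) by (intro mod_pos_pos_trivial) linarith+
  with * show "binop_val w Sub a b = a - b" by (simp add: nat_diff_distrib)
qed simp_all

lemma not_crossing:
  assumes "u \<in> S \<longleftrightarrow> v \<in> S" "u \<noteq> v" "x \<notin> S"
  shows "\<not> (x \<in> {u, v} \<and> {u, v} - {x} \<subseteq> S)"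
  using assms by auto

section \<open>Correctness and running time\<close>

text \<open>Inputs with at least one edge. The exponent 4 in \<open>word_size\<close> leaves room
  for the cubic products in the comparison of quotients.\<close>

locale refine_input =
  fixes n :: nat and es :: "(nat \<times> nat) list" and xs :: "nat list" and w :: nat
  assumes endpoints: "\<And>u v. (u, v) \<in> set es \<Longrightarrow> u < n \<and> v < n \<and> u \<noteq> v"
    and distinct_edges: "distinct (map (\<lambda>(u, v). {u, v}) es)"
    and distinct_xs: "distinct xs"
    and xs_less: "set xs \<subseteq> {..<n}"
    and es_nonempty: "es \<noteq> []"
    and xs_nonempty: "xs \<noteq> []"
    and word_size: "(n + length es + 1) ^ 4 \<le> 2 ^ w"
begin

abbreviation m where "m \<equiv> length es"
abbreviation sz where "sz \<equiv> length xs"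
abbreviation S where "S \<equiv> set xs"
abbreviation edges where "edges i \<equiv> set (take i (map (\<lambda>(u, v). {u, v}) es))"
abbreviation inp where "inp \<equiv> input_words n es xs"
text \<open>Of the \<open>4 * m\<close> cells, \<open>2 * m\<close> hold the edge list and
  \<open>2 * m\<close> are free for the growing output block.\<close>

definition deg_base where "deg_base = 3 + 4 * m + sz"
definition lvl_base where "lvl_base = deg_base + n"
definition deg where "deg i = cross_degree (edges i) S"
abbreviation superlevel where "superlevel i j \<equiv> {v \<in> {..<n} - S. j \<le> deg i v}"
definition level where "level i j = card (superlevel i j)"
definition inner where "inner i = card (edges_within (edges i) S)"
text \<open>The numerator base that the program computes. It may undercount the edges inside the
  extended set: those between two added vertices are missing.\<close>

definition captured where "captured j = inner m + sum (deg m) (superlevel m j)"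

section \<open>Size bounds, edge list prefixes and the input format\<close>

lemma sz_le: "sz \<le> n"
  using card_mono[OF _ xs_less] distinct_card[OF distinct_xs] by simp

lemma m_pos: "m > 0" using es_nonempty by simp
lemma sz_pos: "sz > 0" using xs_nonempty by simp

lemma nth_edge: "i < m \<Longrightarrow> fst (es ! i) < n \<and> snd (es ! i) < n \<and> fst (es ! i) \<noteq> snd (es ! i)"
  using endpoints[of "fst (es ! i)" "snd (es ! i)"] by simp

lemma n_ge: "n \<ge> 2" using nth_edge[OF m_pos] by linarith

text \<open>The base \<open>n + m + 1\<close> is at least 4, whence the factor
  \<open>4 ^ 3 = 64\<close>. This one bound rules out overflow in all addresses and
  counters.\<close>

lemma word_linear: "64 + 64 * n + 64 * m \<le> 2 ^ w"
proof -
  have "4 \<le> n + m + 1" using n_ge m_pos by linarith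
  then have "4 ^ 3 \<le> (n + m + 1) ^ 3" by (intro power_mono) auto
  then have "4 ^ 3 * (n + m + 1) \<le> (n + m + 1) ^ 3 * (n + m + 1)" by (intro mult_right_mono) auto
  also have "\<dots> = (n + m + 1) ^ 4" by (simp add: power4_eq_xxxx power3_eq_cube)
  finally show ?thesis using word_size by simp
qed

lemma word_cubic:
  assumes "x \<le> m" "y \<le> n"
  shows "x * x < 2 ^ w" "x * x * y < 2 ^ w"
proof -
  let ?k = "n + m + 1"
  \<comment> \<open>Using \<open>y + 1\<close> in place of \<open>y\<close> yields both bounds at
    once, also for \<open>y = 0\<close>.\<close>
  have "x * x * (y + 1) \<le> ?k * ?k * ?k" using assms by (intro mult_mono) auto
  also have "\<dots> < ?k * ?k * ?k * ?k" using m_pos by simp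
  also have "\<dots> = ?k ^ 4" by (simp add: power4_eq_xxxx)
  finally have "x * x * (y + 1) < 2 ^ w" using word_size by linarith
  then show "x * x < 2 ^ w" "x * x * y < 2 ^ w" by (simp_all add: algebra_simps)
qed

lemma finite_edges_prefix [simp]: "finite (edges i)" by simp

lemma card_edges_prefix: "i \<le> m \<Longrightarrow> card (edges i) = i"
  using distinct_edges distinct_card[OF distinct_take[OF distinct_edges, of i]] by simp

lemma edges_Suc:
  assumes "i < m"
  shows "edges (Suc i) = insert {fst (es ! i), snd (es ! i)} (edges i)"
    and "{fst (es ! i), snd (es ! i)} \<notin> edges i"
proof -
  let ?L = "map (\<lambda>(u, v). {u, v}) es"
  have *: "?L ! i = {fst (es ! i), snd (es ! i)}" using assms by (simp add: case_prod_beta)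
  have t: "take (Suc i) ?L = take i ?L @ [?L ! i]"
    using assms by (intro take_Suc_conv_app_nth) simp
  show "edges (Suc i) = insert {fst (es ! i), snd (es ! i)} (edges i)"
    unfolding t * by simp
  have "distinct (take (Suc i) ?L)" by (intro distinct_take distinct_edges)
  then show "{fst (es ! i), snd (es ! i)} \<notin> edges i" unfolding t * by simp
qed

lemma deg_Suc:
  assumes "i < m"
  shows "deg (Suc i) x = deg i x + (if x \<in> {fst (es ! i), snd (es ! i)} \<and>
    {fst (es ! i), snd (es ! i)} - {x} \<subseteq> S then 1 else 0)"
  unfolding deg_def edges_Suc(1)[OF assms]
  by (rule cross_degree_insert[OF finite_edges_prefix edges_Suc(2)[OF assms]])

lemma deg_le: "i \<le> m \<Longrightarrow> deg i v \<le> i"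
  unfolding deg_def using cross_degree_le[of "edges i" S v] card_edges_prefix by simp

lemma level_le: "sz + level i j \<le> n"
proof -
  have "card S + level i j = card (S \<union> superlevel i j)" unfolding level_def
    by (intro card_Un_disjoint[symmetric]) auto
  also have "\<dots> \<le> card {..<n}" using xs_less by (intro card_mono) auto
  finally show ?thesis using distinct_card[OF distinct_xs] by simp
qed

lemma inner_le: "i \<le> m \<Longrightarrow> inner i \<le> i"
  using card_mono[of "edges i" "edges_within (edges i) S"] card_edges_prefix[of i]
  by (auto simp: edges_within_def inner_def)

lemma captured_le: "captured j \<le> card (edges_within (edges m) (S \<union> superlevel m j))"
  unfolding captured_def inner_def deg_def by (intro captured_edges_le) auto

lemma captured_le_m: "captured j \<le> m"
proof -
  have "card (edges_within (edges m) (S \<union> superlevel m j)) \<le> card (edges m)"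
    by (intro card_mono) (auto simp: edges_within_def)
  then show ?thesis using captured_le[of j] card_edges_prefix[of m] by linarith
qed

lemma captured_layers:
  "captured j = inner m + j * level m j + (\<Sum>i=Suc j..m. level m i)"
  unfolding captured_def level_def
  using sum_superlevel_layers[of "{..<n} - S" "deg m" m j] deg_le[of m] by simp

lemma superlevel_top: "superlevel m (Suc m) = {}"
  using deg_le[of m] by (auto simp: not_le le_imp_less_Suc)

lemma length_inp: "length inp = 3 + 2 * m + sz"
  by (simp add: input_words_def length_flatten_pairs)

lemma inp_header: "inp ! 0 = n" "inp ! 1 = m" "inp ! 2 = sz"
  by (simp_all add: input_words_def)

lemma inp_flat: "j < 2 * m \<Longrightarrow> inp ! (3 + j) = concat (map (\<lambda>(u, v). [u, v]) es) ! j"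
  by (simp add: input_words_def nth_append length_flatten_pairs)

lemma inp_edge:
  assumes "i < m"
  shows "inp ! (3 + 2 * i) = fst (es ! i)" "inp ! (4 + 2 * i) = snd (es ! i)"
  using inp_flat[of "2 * i"] inp_flat[of "Suc (2 * i)"] nth_flatten_pairs[OF assms] assms by simp_all

lemma inp_set: "i < sz \<Longrightarrow> inp ! (3 + 2 * m + i) = xs ! i"
  by (simp add: input_words_def nth_append length_flatten_pairs)

lemma inp_flat_set: "(\<lambda>j. inp ! (3 + j)) ` {..<2 * m} = \<Union> (edges m)"
proof -
  let ?f = "concat (map (\<lambda>(u, v). [u, v]) es)"
  have "(\<lambda>j. inp ! (3 + j)) ` {..<2 * m} = (\<lambda>j. ?f ! j) ` {..<length ?f}"
    using inp_flat by (intro image_cong) (auto simp: length_flatten_pairs)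
  also have "\<dots> = set ?f" by (auto simp: set_conv_nth)
  also have "\<dots> = \<Union> (edges m)" by auto
  finally show ?thesis .
qed

lemma inp_flat_less: "j < 2 * m \<Longrightarrow> inp ! (3 + j) < n"
proof -
  assume "j < 2 * m"
  then have "inp ! (3 + j) \<in> \<Union> (edges m)" using inp_flat_set by auto
  then show ?thesis using endpoints by fastforce
qed

section \<open>Loop invariants\<close>

definition layout where
  "layout r \<longleftrightarrow> r 1 = 3 + 2 * m \<and> r 2 = n \<and> r (3 :: nat) = m \<and> r 4 = sz \<and>
     r 5 = deg_base \<and> r 6 = lvl_base"

definition mark_inv :: "nat \<Rightarrow> state \<Rightarrow> bool" where
  "mark_inv i st \<longleftrightarrow> (case st of (r, M) \<Rightarrow>
     layout r \<and> r 7 = 3 + 2 * m + i \<and> r 10 = 3 + 2 * m + sz \<and> r 13 = Suc m \<and>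
     (\<forall>j < 3 + 2 * m + sz. M j = inp ! j) \<and>
     (\<forall>v<n. M (deg_base + v) = (if v \<in> set (take i xs) then Suc m else 0)) \<and>
     (\<forall>j\<in>{1..m}. M (lvl_base + j) = 0))"

text \<open>Level cell 0 is never accessed: an incremented degree and a tried threshold are both at
  least 1.\<close>

definition arrays :: "nat \<Rightarrow> (nat \<Rightarrow> nat) \<Rightarrow> bool" where
  "arrays i M \<longleftrightarrow>
     (\<forall>j < 3 + 2 * m + sz. M j = inp ! j) \<and>
     (\<forall>v<n. M (deg_base + v) = (if v \<in> S then Suc m else deg i v)) \<and>
     (\<forall>j\<in>{1..m}. M (lvl_base + j) = level i j)"

definition edge_inv :: "nat \<Rightarrow> state \<Rightarrow> bool" where
  "edge_inv i st \<longleftrightarrow> (case st of (r, M) \<Rightarrow>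
     layout r \<and> r 7 = 3 + 2 * i \<and> r 8 = inner i \<and> r 13 = Suc m \<and> arrays i M)"

text \<open>Maximality of the quotient \<open>captured\<^sup>2 / size\<close> among the thresholds
  tried so far, cross-multiplied into natural numbers exactly as the program compares them.\<close>

definition best_threshold :: "nat \<Rightarrow> nat \<Rightarrow> bool" where
  "best_threshold d b \<longleftrightarrow> b \<in> {d..Suc m} \<and>
     (\<forall>j\<in>{d..Suc m}. (captured j)\<^sup>2 * (sz + level m b) \<le> (captured b)\<^sup>2 * (sz + level m j))"

definition threshold_inv :: "nat \<Rightarrow> state \<Rightarrow> bool" where
  "threshold_inv i st \<longleftrightarrow> (case st of (r, M) \<Rightarrow>
     layout r \<and> arrays m M \<and> r 8 = inner m \<and> r 14 = m - i \<and>
     r 9 = (\<Sum>j=Suc (m - i)..m. level m j) \<and>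
     best_threshold (Suc (m - i)) (r 13) \<and>
     r 11 = captured (r 13) \<and> r 12 = sz + level m (r 13))"

text \<open>The bounds on \<open>r 0\<close> keep new output cells behind the input and before the
  degree array.\<close>

definition output_inv :: "nat \<Rightarrow> nat \<Rightarrow> state \<Rightarrow> bool" where
  "output_inv b i st \<longleftrightarrow> (case st of (r, M) \<Rightarrow>
     layout r \<and> r 7 = 3 + i \<and> r 13 = b \<and> sz \<le> r 0 \<and> r 0 \<le> sz + i \<and>
     (\<forall>j < 3 + 2 * m + sz. M j = inp ! j) \<and>
     (\<forall>v<n. M (deg_base + v) = (if v \<in> S then Suc m else deg m v)) \<and>
     M ` {r 1..<r 1 + r 0} = S \<union>
       {v \<in> (\<lambda>j. inp ! (3 + j)) ` {..<i}. v \<in> S \<or> b \<le> deg m v})"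

section \<open>One iteration of each loop\<close>

lemma mark_step:
  assumes i: "i < sz" and "mark_inv i st"
  shows "test_val w (fst st) (Less (Reg 7) (Reg 10)) \<and>
    runs w mark_body st (\<lambda>t st'. t \<le> 10 \<and> mark_inv (Suc i) st')"
proof -
  obtain r M where st: "st = (r, M)" by (cases st)
  note inv = assms(2)[unfolded mark_inv_def layout_def st prod.case]
  have x: "M (3 + 2 * m + i) = xs ! i" using inv inp_set i by auto
  have xn: "xs ! i < n" using xs_less i nth_mem by blast
  have tk: "set (take (Suc i) xs) = insert (xs ! i) (set (take i xs))"
    using i by (simp add: take_Suc_conv_app_nth)
  have W: "64 + 64 * n + 64 * m \<le> 2 ^ w" by (rule word_linear)
  have ad: "binop_val w Add deg_base (xs ! i) = deg_base + xs ! i"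
    using W xn sz_le unfolding deg_base_def by (intro binop_val_exact) linarith
  have inc: "binop_val w Add (3 + 2 * m + i) (Suc 0) = 3 + 2 * m + Suc i"
    using W i sz_le binop_val_exact(1)[of "3 + 2 * m + i" 1 w] by simp
  \<comment> \<open>The simplifier rewrites the program constant 1 to \<open>Suc 0\<close>, hence
    this form; unfolding \<open>operand_val\<close> instead would leave a
    \<open>mod\<close>.\<close>
  have cs: "operand_val w q (Const (Suc 0)) = Suc 0" for q
    using W by (simp add: binop_val_exact(4) del: operand_val.simps(1))
  have regs: "r (Suc 0) = 3 + 2 * m" "r 3 = m" "r 5 = deg_base" "r 6 = lvl_base" "r 2 = n" "r 4 = sz"
    "r 7 = 3 + 2 * m + i" "r 10 = 3 + 2 * m + sz" "r 13 = Suc m" using inv by simp_all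
  let ?M = "M(deg_base + xs ! i := Suc m)"
  have "\<forall>j < 3 + 2 * m + sz. ?M j = inp ! j" using inv by (simp add: deg_base_def)
  moreover have "\<forall>v<n. ?M (deg_base + v) = (if v \<in> set (take (Suc i) xs) then Suc m else 0)"
    using inv unfolding tk by simp
  moreover have "\<forall>j\<in>{1..m}. ?M (lvl_base + j) = 0" using inv xn by (simp add: lvl_base_def)
  moreover have "runs w mark_body st (\<lambda>t (r', M'). t \<le> 10 \<and> M' = ?M \<and> layout r' \<and>
      r' 7 = 3 + 2 * m + Suc i \<and> r' 10 = 3 + 2 * m + sz \<and> r' 13 = Suc m)"
    unfolding st mark_body_def layout_def
    by (simp add: regs x ad inc cs del: binop_val.simps operand_val.simps(1))
  ultimately have "runs w mark_body st (\<lambda>t st'. t \<le> 10 \<and> mark_inv (Suc i) st')"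
    unfolding mark_inv_def by (elim runs_mono) auto
  moreover have "test_val w (fst st) (Less (Reg 7) (Reg 10))" using i by (simp add: st regs)
  ultimately show ?thesis by blast
qed

lemma deg_unaffected:
  assumes i: "i < m" and "fst (es ! i) \<in> S \<longleftrightarrow> snd (es ! i) \<in> S" "x \<notin> S"
  shows "deg (Suc i) x = deg i x"
proof -
  have "fst (es ! i) \<noteq> snd (es ! i)" using nth_edge[OF i] by blast
  from not_crossing[OF assms(2) this assms(3)] show ?thesis unfolding deg_Suc[OF i] by (simp only: if_False add_0_right)
qed

lemma arrays_unaffected:
  assumes "i < m" "arrays i M" "fst (es ! i) \<in> S \<longleftrightarrow> snd (es ! i) \<in> S"
  shows "arrays (Suc i) M"
proof -
  note deg = deg_unaffected[OF assms(1,3)]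
  have "superlevel (Suc i) j = superlevel i j" for j 
  proof (rule Collect_cong)
    fix v show "(v \<in> {..<n} - S \<and> j \<le> deg (Suc i) v) = (v \<in> {..<n} - S \<and> j \<le> deg i v)"
     using deg[of v] by (simp cong: conj_cong)
  qed
  then have "level (Suc i) j = level i j" for j by (simp only: level_def)
  then show ?thesis using assms(2) unfolding arrays_def by (simp add: deg)
qed

lemma arrays_bump:
  assumes i: "i < m" and M: "arrays i M" and uv: "{fst (es ! i), snd (es ! i)} = {u, v}"
    and u: "u \<in> S" and v: "v \<notin> S" "v < n"
  shows "arrays (Suc i) (M(deg_base + v := Suc (deg i v),
    lvl_base + Suc (deg i v) := Suc (M (lvl_base + Suc (deg i v)))))"
proof -
  let ?X = "{..<n} - S"
  have d: "deg (Suc i) x = ((deg i)(v := Suc (deg i v))) x" if "x \<notin> S" for x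
    unfolding deg_Suc[OF i] uv using that u v by auto
  have l: "level (Suc i) j = level i j + (if j = Suc (deg i v) then 1 else 0)" for j
  proof -
    have "superlevel (Suc i) j = {x \<in> ?X. j \<le> ((deg i)(v := Suc (deg i v))) x}"
      using d by auto
    then show ?thesis using card_superlevel_increment[of ?X v j "deg i"] v by (simp add: level_def)
  qed
  \<comment> \<open>At most \<open>i < m\<close> edges precede this one, so the new degree stays
    within the level array and below the mark \<open>Suc m\<close>.\<close>
  have "Suc (deg i v) \<in> {1..m}" using deg_le[of i v] i by simp
  then have "M (lvl_base + Suc (deg i v)) = level i (Suc (deg i v))"
    using M unfolding arrays_def by blast
  note lv = this
  let ?M = "M(deg_base + v := Suc (deg i v),
    lvl_base + Suc (deg i v) := Suc (M (lvl_base + Suc (deg i v))))"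
  show ?thesis unfolding arrays_def
  proof (intro conjI allI impI ballI)
    fix j assume "j < 3 + 2 * m + sz"
    then show "?M j = inp ! j" using M by (simp add: arrays_def deg_base_def lvl_base_def)
  next
    fix x assume "x < n"
    then have "?M (deg_base + x) = (if x = v then Suc (deg i v) else M (deg_base + x))"
      by (simp add: lvl_base_def)
    then show "?M (deg_base + x) = (if x \<in> S then Suc m else deg (Suc i) x)"
      using M v \<open>x < n\<close> d[of x] unfolding arrays_def by auto
  next
    fix j assume j: "j \<in> {1..m}"
    have eq: "?M (lvl_base + j)
      = (if j = Suc (deg i v) then Suc (M (lvl_base + Suc (deg i v))) else M (lvl_base + j))"
      using v by (simp add: lvl_base_def)
    show "?M (lvl_base + j) = level (Suc i) j"
      unfolding eq using M j lv l[of j] unfolding arrays_def by auto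
  qed
qed

lemma inner_Suc:
  assumes "i < m"
  shows "inner (Suc i) = inner i + (if fst (es ! i) \<in> S \<and> snd (es ! i) \<in> S then 1 else 0)"
proof -
  let ?e = "{fst (es ! i), snd (es ! i)}"
  have "edges_within (edges (Suc i)) S =
    (if ?e \<subseteq> S then insert ?e (edges_within (edges i) S) else edges_within (edges i) S)"
    unfolding edges_Suc(1)[OF assms] by (auto simp: edges_within_def)
  then show ?thesis using edges_Suc(2)[OF assms] by (auto simp: edges_within_def inner_def)
qed

lemma edge_step:
  assumes i: "i < m" and "edge_inv i st"
  shows "test_val w (fst st) (Less (Reg 7) (Reg 1)) \<and>
    runs w edge_body st (\<lambda>t st'. t \<le> 20 \<and> edge_inv (Suc i) st')"
proof -
  obtain r M where st: "st = (r, M)" by (cases st)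
  note inv = assms(2)[unfolded edge_inv_def layout_def st prod.case]
  then have A: "arrays i M" by blast
  define u where "u = fst (es ! i)"
  define v where "v = snd (es ! i)"
  have uv: "u < n" "v < n" "u \<noteq> v" using nth_edge[OF i] by (auto simp: u_def v_def)
  have "3 + 2 * i < 3 + 2 * m + sz" "4 + 2 * i < 3 + 2 * m + sz" using i by linarith+
  then have e: "M (3 + 2 * i) = u" "M (4 + 2 * i) = v"
    using A inp_edge[OF i] unfolding arrays_def u_def v_def by auto
  have dg: "M (deg_base + x) = (if x \<in> S then Suc m else deg i x)" if "x < n" for x
    using A that unfolding arrays_def by blast
  \<comment> \<open>This decides the tests for membership in \<open>S\<close>: the cell of an
    outside vertex never exceeds \<open>m\<close>.\<close>
  have dle: "deg i x < m" for x using deg_le[of i x] i by simp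
  have lv: "M (lvl_base + Suc (deg i x)) \<le> n" for x
  proof -
    have "Suc (deg i x) \<in> {1..m}" using dle[of x] by simp
    then have "M (lvl_base + Suc (deg i x)) = level i (Suc (deg i x))"
      using A unfolding arrays_def by blast
    then show ?thesis using level_le[of i "Suc (deg i x)"] by linarith
  qed
  have W: "64 + 64 * n + 64 * m \<le> 2 ^ w" by (rule word_linear)
  have ad: "binop_val w Add deg_base x = deg_base + x" if "x < n" for x
    using W that sz_le unfolding deg_base_def by (intro binop_val_exact) linarith
  have al: "binop_val w Add lvl_base (Suc (deg i x)) = lvl_base + Suc (deg i x)" for x
    using W dle[of x] sz_le unfolding deg_base_def lvl_base_def by (intro binop_val_exact) linarith
  have inc: "binop_val w Add k (Suc 0) = Suc k" if "k \<le> n + m" for k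
    using W that binop_val_exact(1)[of k 1 w] by simp
  have inc7: "binop_val w Add (3 + 2 * i) (Suc 0) = 4 + 2 * i"
    "binop_val w Add (3 + 2 * i) 2 = 3 + 2 * Suc i"
    using W i binop_val_exact(1)[of "3 + 2 * i" 1 w] binop_val_exact(1)[of "3 + 2 * i" 2 w] by simp_all
  have cs: "operand_val w q (Const (Suc 0)) = Suc 0" "operand_val w q (Const 2) = 2" for q
    using W by (simp_all add: binop_val_exact(4) del: operand_val.simps(1))
  note inc' = inc[of "deg i _"] inc[of "M (lvl_base + Suc (deg i _))"] inc[of "inner i"]
  have bnd: "deg i x \<le> n + m" "M (lvl_base + Suc (deg i x)) \<le> n + m" "inner i \<le> n + m" for x
    using dle[of x] lv[of x] inner_le[of i] i by simp_all
  have neq: "lvl_base + y \<noteq> deg_base + x" if "x < n" for x y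
    using that by (simp add: lvl_base_def)
  have regs: "r (Suc 0) = 3 + 2 * m" "r 3 = m" "r 5 = deg_base" "r 6 = lvl_base" "r 7 = 3 + 2 * i"
    "r 2 = n" "r 4 = sz" "r 8 = inner i" "r 13 = Suc m" using inv by simp_all
  note exec_simps = regs e dg uv ad al inc' inc7 bnd cs neq less_not_sym[OF dle]
  note S1 = inner_Suc[OF i, folded u_def v_def]
  note un = arrays_unaffected[OF i A, folded u_def v_def]
  note bu = arrays_bump[OF i A, folded u_def v_def]
  have test: "test_val w (fst st) (Less (Reg 7) (Reg 1))" using i by (simp add: st regs)
  consider "u \<in> S" "v \<in> S" | "u \<in> S" "v \<notin> S" | "u \<notin> S" "v \<in> S" | "u \<notin> S" "v \<notin> S" by blast
  then have "runs w edge_body st (\<lambda>t st'. t \<le> 20 \<and> edge_inv (Suc i) st')"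
  proof cases
    case 1
    with un have "arrays (Suc i) M" by simp
    then show ?thesis unfolding st edge_body_def edge_inv_def layout_def
      by (simp add: exec_simps 1 S1 del: binop_val.simps operand_val.simps(1))
  next
    case 2
    let ?M = "M(deg_base + v := Suc (deg i v),
      lvl_base + Suc (deg i v) := Suc (M (lvl_base + Suc (deg i v))))"
    have "runs w edge_body st (\<lambda>t (r', M'). t \<le> 20 \<and> M' = ?M \<and> layout r' \<and>
        r' 7 = 3 + 2 * Suc i \<and> r' 8 = inner (Suc i) \<and> r' 13 = Suc m)"
      unfolding st edge_body_def bump_prog_def layout_def
      by (simp add: exec_simps 2 S1 del: binop_val.simps operand_val.simps(1) add_Suc_right)
    then show ?thesis using bu[of u v] 2 uv unfolding edge_inv_def by (elim runs_mono) auto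
  next
    case 3
    let ?M = "M(deg_base + u := Suc (deg i u),
      lvl_base + Suc (deg i u) := Suc (M (lvl_base + Suc (deg i u))))"
    have "runs w edge_body st (\<lambda>t (r', M'). t \<le> 20 \<and> M' = ?M \<and> layout r' \<and>
        r' 7 = 3 + 2 * Suc i \<and> r' 8 = inner (Suc i) \<and> r' 13 = Suc m)"
      unfolding st edge_body_def bump_prog_def layout_def
      by (simp add: exec_simps 3 S1 del: binop_val.simps operand_val.simps(1) add_Suc_right)
    then show ?thesis using bu[of v u] 3 uv unfolding edge_inv_def
      by (elim runs_mono) (auto simp: insert_commute)
  next
    case 4
    with un have "arrays (Suc i) M" by simp
    then show ?thesis unfolding st edge_body_def edge_inv_def layout_def
      by (simp add: exec_simps 4 S1 del: binop_val.simps operand_val.simps(1))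
  qed
  with test show ?thesis by blast
qed

lemma best_threshold_keep:
  assumes "best_threshold (Suc k) b"
    "\<not> (captured b)\<^sup>2 * (sz + level m k) < (captured k)\<^sup>2 * (sz + level m b)"
  shows "best_threshold k b"
  unfolding best_threshold_def
proof (intro conjI ballI)
  show "b \<in> {k..Suc m}" using assms(1) by (simp add: best_threshold_def)
next
  fix j assume "j \<in> {k..Suc m}"
  then show "(captured j)\<^sup>2 * (sz + level m b) \<le> (captured b)\<^sup>2 * (sz + level m j)"
    using assms by (cases "j = k") (simp_all add: best_threshold_def not_less)
qed

text \<open>Transitivity of the order of quotients in cross-multiplied form: the two comparisons
  share the factor \<open>sz + level m b\<close>, which is positive because \<open>S\<close> is
  nonempty, and cancels.\<close>

lemma best_threshold_replace:
  assumes "best_threshold (Suc k) b" "k \<le> m"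
    "(captured b)\<^sup>2 * (sz + level m k) < (captured k)\<^sup>2 * (sz + level m b)"
  shows "best_threshold k k"
  unfolding best_threshold_def
proof (intro conjI ballI)
  show "k \<in> {k..Suc m}" using assms(2) by simp
next
  fix j assume j: "j \<in> {k..Suc m}"
  let ?y = "\<lambda>j. sz + level m j"
  show "(captured j)\<^sup>2 * ?y k \<le> (captured k)\<^sup>2 * ?y j"
  proof (cases "j = k")
    case False
    with j have "(captured j)\<^sup>2 * ?y b \<le> (captured b)\<^sup>2 * ?y j"
      using assms(1) by (simp add: best_threshold_def)
    then have "(captured j)\<^sup>2 * ?y b * ?y k \<le> (captured b)\<^sup>2 * ?y j * ?y k"
      by (rule mult_right_mono) simp
    also have "\<dots> = (captured b)\<^sup>2 * ?y k * ?y j" by (simp only: mult_ac)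
    also have "\<dots> \<le> (captured k)\<^sup>2 * ?y b * ?y j"
      by (rule mult_right_mono[OF less_imp_le[OF assms(3)]]) simp
    finally have "?y b * ((captured j)\<^sup>2 * ?y k) \<le> ?y b * ((captured k)\<^sup>2 * ?y j)"
      by (simp only: mult_ac)
    moreover have "?y b > 0" using sz_pos by (rule trans_less_add1)
    ultimately show ?thesis by (rule mult_left_le_imp_le)
  qed (rule order.refl | simp)+
qed

lemma threshold_step:
  assumes i: "i < m" and "threshold_inv i st"
  shows "test_val w (fst st) (Less (Const 0) (Reg 14)) \<and>
    runs w threshold_body st (\<lambda>t st'. t \<le> 20 \<and> threshold_inv (Suc i) st')"
proof -
  obtain r M where st: "st = (r, M)" by (cases st)
  note inv = assms(2)[unfolded threshold_inv_def layout_def st prod.case]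
  then have A: "arrays m M" by blast
  define k where "k = m - i"
  have k: "k \<in> {1..m}" "m - Suc i = k - 1" "Suc (k - 1) = k" using i by (auto simp: k_def)
  define b where "b = r 13"
  define R where "R = (\<Sum>j=Suc k..m. level m j)"
  have best: "best_threshold (Suc k) b" using inv by (simp add: k_def b_def)
  have c: "M (lvl_base + k) = level m k" using A k(1) unfolding arrays_def by blast
  have cap: "captured k = inner m + k * level m k + R" by (simp only: captured_layers R_def)
  have sumk: "(\<Sum>j=k..m. level m j) = R + level m k"
    using k(1) by (simp add: sum.atLeast_Suc_atMost R_def)
  have W: "64 + 64 * n + 64 * m \<le> 2 ^ w" by (rule word_linear)
  have le: "captured j \<le> m" "sz + level m j \<le> n" for j
    by (rule captured_le_m, rule level_le)
  have y: "binop_val w Add sz (level m k) = sz + level m k"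
    using W le(2)[of k] by (intro binop_val_exact) linarith
  have al: "binop_val w Add lvl_base k = lvl_base + k"
    using W k(1) sz_le unfolding deg_base_def lvl_base_def
    by (intro binop_val_exact) (simp only: atLeastAtMost_iff, linarith)
  \<comment> \<open>The intermediate values in \<open>x1\<close>, \<open>x2\<close> and
    \<open>x3\<close> are partial sums of \<open>captured k\<close>, hence at most
    \<open>m\<close>.\<close>
  have x1: "binop_val w Mult k (level m k) = k * level m k"
    using W cap le(1)[of k] by (intro binop_val_exact) linarith
  have x2: "binop_val w Add (k * level m k) R = k * level m k + R"
    using W cap le(1)[of k] by (intro binop_val_exact) linarith
  have x3: "binop_val w Add (k * level m k + R) (inner m) = captured k"
    using W cap le(1)[of k] binop_val_exact(1)[of "k * level m k + R" "inner m" w] by linarith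
  have sq: "binop_val w Mult (captured j) (captured j) = captured j * captured j" for j
    by (intro binop_val_exact word_cubic[OF le])
  have sq2: "binop_val w Mult (captured j * captured j) (sz + level m l)
      = (captured j)\<^sup>2 * (sz + level m l)" for j l
    unfolding power2_eq_square by (intro binop_val_exact word_cubic[OF le])
  have r9: "binop_val w Add R (level m k) = R + level m k"
    using W cap le[of k] by (intro binop_val_exact) linarith
  have dec: "binop_val w Sub k (Suc 0) = k - 1"
    using W k(1) binop_val_exact(3)[of 1 k w] by simp
  have cs: "operand_val w q (Const (Suc 0)) = Suc 0" "operand_val w q (Const 0) = 0" for q
    using W by (simp_all add: binop_val_exact(4) del: operand_val.simps(1))
  have regs: "r (Suc 0) = 3 + 2 * m" "r 2 = n" "r 3 = m" "r 4 = sz" "r 5 = deg_base" "r 6 = lvl_base"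
    "r 8 = inner m" "r 9 = R" "r 11 = captured b" "r 12 = sz + level m b" "r 13 = b" "r 14 = k"
    using inv by (simp_all add: k_def R_def b_def)
  note exec_simps = regs c y al x1 x2 x3 sq sq2 r9 dec cs
  have "runs w threshold_body st (\<lambda>t (r', M'). t \<le> 20 \<and> M' = M \<and> layout r' \<and>
    r' 8 = inner m \<and> r' 14 = k - 1 \<and> r' 9 = R + level m k \<and> best_threshold k (r' 13) \<and>
    r' 11 = captured (r' 13) \<and> r' 12 = sz + level m (r' 13))"
  proof (cases "(captured b)\<^sup>2 * (sz + level m k) < (captured k)\<^sup>2 * (sz + level m b)")
    case True
    then have "best_threshold k k" using best_threshold_replace best k(1) by simp
    then show ?thesis unfolding st threshold_body_def layout_def
      by (simp add: exec_simps True del: binop_val.simps operand_val.simps(1))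
  next
    case False
    then have "best_threshold k b" using best_threshold_keep best by simp
    then show ?thesis unfolding st threshold_body_def layout_def
      by (simp add: exec_simps False del: binop_val.simps operand_val.simps(1))
  qed
  then have "runs w threshold_body st (\<lambda>t st'. t \<le> 20 \<and> threshold_inv (Suc i) st')"
    unfolding threshold_inv_def k(2) k(3) sumk using A by (elim runs_mono) auto
  moreover have "test_val w (fst st) (Less (Const 0) (Reg 14))"
    using k(1) by (simp add: st regs cs del: operand_val.simps(1))
  ultimately show ?thesis by blast
qed

lemma output_step:
  assumes i: "i < 2 * m" and b: "b \<le> Suc m" and "output_inv b i st"
  shows "test_val w (fst st) (Less (Reg 7) (Reg 1)) \<and>
    runs w output_body st (\<lambda>t st'. t \<le> 12 \<and> output_inv b (Suc i) st')"
proof -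
  obtain r M where st: "st = (r, M)" by (cases st)
  note inv = assms(3)[unfolded output_inv_def layout_def st prod.case]
  define u where "u = inp ! (3 + i)"
  define l where "l = r 0"
  have u: "u < n" unfolding u_def by (rule inp_flat_less[OF i])
  have l: "sz \<le> l" "l \<le> sz + i" using inv by (auto simp: l_def)
  have Mu: "M (3 + i) = u" using inv i by (simp add: u_def)
  have du: "M (deg_base + u) = (if u \<in> S then Suc m else deg m u)" using inv u by blast
  have out: "M ` {3 + 2 * m..<3 + 2 * m + l} = S \<union>
      {v \<in> (\<lambda>j. inp ! (3 + j)) ` {..<i}. v \<in> S \<or> b \<le> deg m v}"
  proof -
    have "r 1 = 3 + 2 * m" using inv by blast
    moreover have "M ` {r 1..<r 1 + r 0} = S \<union>
      {v \<in> (\<lambda>j. inp ! (3 + j)) ` {..<i}. v \<in> S \<or> b \<le> deg m v}" using inv by blast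
    ultimately show ?thesis by (simp only: l_def)
  qed
  have W: "64 + 64 * n + 64 * m \<le> 2 ^ w" by (rule word_linear)
  have ad: "binop_val w Add deg_base u = deg_base + u"
    using W u sz_le unfolding deg_base_def by (intro binop_val_exact) linarith
  have ou: "binop_val w Add (3 + 2 * m) l = 3 + 2 * m + l"
    using W l i sz_le by (intro binop_val_exact) linarith
  have i0: "binop_val w Add l (Suc 0) = Suc l"
    using W l i sz_le binop_val_exact(1)[of l 1 w] by simp
  have i7: "binop_val w Add (3 + i) (Suc 0) = 3 + Suc i"
    using W i binop_val_exact(1)[of "3 + i" 1 w] by simp
  have cs: "operand_val w q (Const (Suc 0)) = Suc 0" for q
    using W by (simp add: binop_val_exact(4) del: operand_val.simps(1))
  have regs: "r (Suc 0) = 3 + 2 * m" "r 2 = n" "r 3 = m" "r 4 = sz" "r 5 = deg_base" "r 6 = lvl_base"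
    "r 7 = 3 + i" "r 13 = b" "r 0 = l"
    using inv by (simp_all add: l_def)
  have Suc_image: "(\<lambda>j. inp ! (3 + j)) ` {..<Suc i} = insert u ((\<lambda>j. inp ! (3 + j)) ` {..<i})"
    by (simp add: lessThan_Suc u_def)
  have test: "test_val w (fst st) (Less (Reg 7) (Reg 1))" using i by (simp add: st regs)
  have "runs w output_body st (\<lambda>t st'. t \<le> 12 \<and> output_inv b (Suc i) st')"
  proof (cases "M (deg_base + u) < b")
    case True
    \<comment> \<open>As \<open>b \<le> Suc m\<close>, a cell below \<open>b\<close> cannot carry
      the mark, so \<open>u\<close> lies outside \<open>S\<close> and has too small a
      degree.\<close>
    then have "{v \<in> (\<lambda>j. inp ! (3 + j)) ` {..<Suc i}. v \<in> S \<or> b \<le> deg m v}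
      = {v \<in> (\<lambda>j. inp ! (3 + j)) ` {..<i}. v \<in> S \<or> b \<le> deg m v}"
      unfolding Suc_image using du b by (auto split: if_splits)
    with out have eq: "M ` {3 + 2 * m..<3 + 2 * m + l} = S \<union>
      {v \<in> (\<lambda>j. inp ! (3 + j)) ` {..<Suc i}. v \<in> S \<or> b \<le> deg m v}" by (simp only:)
    have "runs w output_body st (\<lambda>t (r', M'). t \<le> 12 \<and> M' = M \<and> layout r' \<and>
      r' 7 = 3 + Suc i \<and> r' 13 = b \<and> r' 0 = l)"
      unfolding st output_body_def layout_def
      by (simp add: regs Mu ad i7 cs True del: binop_val.simps operand_val.simps(1))
    then show ?thesis
    proof (rule runs_mono)
      fix t :: nat and st'
      assume *: "case st' of (r', M') \<Rightarrow> t \<le> 12 \<and> M' = M \<and> layout r' \<and>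
        r' 7 = 3 + Suc i \<and> r' 13 = b \<and> r' 0 = l"
      obtain r' M' where st': "st' = (r', M')" by (cases st')
      have L: "layout r'" "M' = M" "t \<le> 12" "r' 7 = 3 + Suc i" "r' 13 = b" "r' 0 = l"
        using * unfolding st' by blast+
      have bnds: "sz \<le> r' 0" "r' 0 \<le> sz + Suc i" unfolding L(6) using l by simp_all
      have keep: "\<forall>j < 3 + 2 * m + sz. M' j = inp ! j"
        "\<forall>v<n. M' (deg_base + v) = (if v \<in> S then Suc m else deg m v)"
        unfolding L(2) using inv by blast+
      have "r' 1 = 3 + 2 * m" using L(1) unfolding layout_def by blast
      then have "M' ` {r' 1..<r' 1 + r' 0}
        = S \<union> {v \<in> (\<lambda>j. inp ! (3 + j)) ` {..<Suc i}. v \<in> S \<or> b \<le> deg m v}"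
        unfolding L(2) L(6) using eq by (simp only:)
      then show "t \<le> 12 \<and> output_inv b (Suc i) st'"
        using L(1,3,4,5) bnds keep unfolding st' output_inv_def prod.case by blast
    qed
  next
    case False
    let ?M = "M(3 + 2 * m + l := u)"
    have eq: "{v \<in> (\<lambda>j. inp ! (3 + j)) ` {..<Suc i}. v \<in> S \<or> b \<le> deg m v}
      = insert u {v \<in> (\<lambda>j. inp ! (3 + j)) ` {..<i}. v \<in> S \<or> b \<le> deg m v}"
      unfolding Suc_image using du False by (auto split: if_splits)
    have "{3 + 2 * m..<3 + 2 * m + Suc l} = insert (3 + 2 * m + l) {3 + 2 * m..<3 + 2 * m + l}" by auto
    then have "?M ` {3 + 2 * m..<3 + 2 * m + Suc l} = insert u (M ` {3 + 2 * m..<3 + 2 * m + l})"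
      by auto
    then have o: "?M ` {3 + 2 * m..<3 + 2 * m + Suc l}
      = S \<union> {v \<in> (\<lambda>j. inp ! (3 + j)) ` {..<Suc i}. v \<in> S \<or> b \<le> deg m v}"
      unfolding out eq by (simp only: Un_insert_right)
    \<comment> \<open>The written cell lies behind the input since \<open>sz \<le> l\<close>, and
      before the degree array since \<open>l \<le> sz + i < sz + 2 * m\<close>.\<close>
    have i1: "\<forall>j < 3 + 2 * m + sz. ?M j = inp ! j" using inv l by simp
    have i2: "\<forall>v<n. ?M (deg_base + v) = (if v \<in> S then Suc m else deg m v)"
      using inv l i by (simp add: deg_base_def)
    have "runs w output_body st (\<lambda>t (r', M'). t \<le> 12 \<and> M' = ?M \<and> layout r' \<and>
      r' 7 = 3 + Suc i \<and> r' 13 = b \<and> r' 0 = Suc l)"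
      unfolding st output_body_def layout_def
      by (simp add: regs Mu ad ou i0 i7 cs False del: binop_val.simps operand_val.simps(1))
    then show ?thesis
    proof (rule runs_mono)
      fix t :: nat and st'
      assume *: "case st' of (r', M') \<Rightarrow> t \<le> 12 \<and> M' = ?M \<and> layout r' \<and>
        r' 7 = 3 + Suc i \<and> r' 13 = b \<and> r' 0 = Suc l"
      obtain r' M' where st': "st' = (r', M')" by (cases st')
      have L: "layout r'" "M' = ?M" "t \<le> 12" "r' 7 = 3 + Suc i" "r' 13 = b" "r' 0 = Suc l"
        using * unfolding st' by blast+
      have bnds: "sz \<le> r' 0" "r' 0 \<le> sz + Suc i" unfolding L(6) using l by simp_all
      have keep: "\<forall>j < 3 + 2 * m + sz. M' j = inp ! j"
        "\<forall>v<n. M' (deg_base + v) = (if v \<in> S then Suc m else deg m v)"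
        unfolding L(2) using i1 i2 by blast+
      have "r' 1 = 3 + 2 * m" using L(1) unfolding layout_def by blast
      then have "M' ` {r' 1..<r' 1 + r' 0}
        = S \<union> {v \<in> (\<lambda>j. inp ! (3 + j)) ` {..<Suc i}. v \<in> S \<or> b \<le> deg m v}"
        unfolding L(2) L(6) using o by (simp only:)
      then show "t \<le> 12 \<and> output_inv b (Suc i) st'"
        using L(1,3,4,5) bnds keep unfolding st' output_inv_def prod.case by blast
    qed
  qed
  with test show ?thesis by blast
qed

section \<open>Assembling the phases and quality of the result\<close>

lemma mark_start:
  assumes st: "st = ((\<lambda>_. 0)(3 := m), \<lambda>i. if i < length inp then inp ! i else 0)"
  shows "runs w setup_prog st (\<lambda>t st'. t \<le> 12 \<and> mark_inv 0 st')"
proof -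
  \<comment> \<open>Register 3 already holds \<open>m\<close> in the starting state:
    \<open>refine_prog\<close> loads it before branching.\<close>
  define N where "N = (\<lambda>i. if i < length inp then inp ! i else 0)"
  have W: "64 + 64 * n + 64 * m \<le> 2 ^ w" by (rule word_linear)
  have hd: "N 0 = n" "N 2 = sz" using inp_header length_inp by (simp_all add: N_def)
  have cs: "operand_val w q (Const (Suc 0)) = Suc 0" "operand_val w q (Const 2) = 2"
    "operand_val w q (Const 3) = 3" "operand_val w q (Const 0) = 0" for q
    using W by (simp_all add: binop_val_exact(4) del: operand_val.simps(1))
  have ar: "binop_val w Mult 2 m = 2 * m" "binop_val w Add (2 * m) 3 = 3 + 2 * m"
    "binop_val w Add (3 + 2 * m) sz = 3 + 2 * m + sz"
    "binop_val w Add (3 + 2 * m + sz) (2 * m) = deg_base"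
    "binop_val w Add deg_base n = lvl_base" "binop_val w Add m (Suc 0) = Suc m"
    using W sz_le binop_val_exact(2)[of 2 m w] binop_val_exact(1)[of "2 * m" 3 w]
      binop_val_exact(1)[of "3 + 2 * m" sz w] binop_val_exact(1)[of "3 + 2 * m + sz" "2 * m" w]
      binop_val_exact(1)[of deg_base n w] binop_val_exact(1)[of m 1 w]
    by (simp_all add: deg_base_def lvl_base_def del: binop_val.simps)
  have M: "\<forall>j < 3 + 2 * m + sz. N j = inp ! j" "\<forall>v<n. N (deg_base + v) = 0"
    "\<forall>j\<in>{1..m}. N (lvl_base + j) = 0"
    by (simp_all add: N_def length_inp deg_base_def lvl_base_def)
  have "runs w setup_prog st (\<lambda>t (r', M'). t \<le> 12 \<and> M' = N \<and> layout r' \<and>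
      r' 7 = 3 + 2 * m \<and> r' 10 = 3 + 2 * m + sz \<and> r' 13 = Suc m)"
    unfolding st N_def[symmetric] setup_prog_def layout_def
    by (simp add: hd cs ar del: binop_val.simps operand_val.simps(1))
  then show ?thesis using M unfolding mark_inv_def by (elim runs_mono) auto
qed

lemma mark_phase:
  "mark_inv 0 st \<Longrightarrow>
    runs w (While (Less (Reg 7) (Reg 10)) mark_body) st (\<lambda>t st'. t \<le> sz * (10 + 1) + 1 \<and> mark_inv sz st')"
  by (rule runs_While[where I = mark_inv, OF _ mark_step]) (auto simp: mark_inv_def)

lemma edge_start:
  assumes "mark_inv sz st"
  shows "runs w (block [Move 7 (Const 3), Move 8 (Const 0)]) st (\<lambda>t st'. t \<le> 3 \<and> edge_inv 0 st')"
proof -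
  obtain r M where st: "st = (r, M)" by (cases st)
  have d: "deg 0 v = 0" for v by (simp add: deg_def cross_degree_def)
  have "level 0 j = 0" if "j \<in> {1..m}" for j using that by (simp add: level_def d)
  moreover have "inner 0 = 0" by (simp add: inner_def edges_within_def)
  moreover have "3 < (2::nat) ^ w" using word_linear by linarith
  ultimately show ?thesis using assms d unfolding st mark_inv_def edge_inv_def arrays_def layout_def
    by simp
qed

lemma edge_phase:
  "edge_inv 0 st \<Longrightarrow>
    runs w (While (Less (Reg 7) (Reg 1)) edge_body) st (\<lambda>t st'. t \<le> m * (20 + 1) + 1 \<and> edge_inv m st')"
  by (rule runs_While[where I = edge_inv, OF _ edge_step]) (auto simp: edge_inv_def layout_def)

text \<open>The search starts at the threshold \<open>Suc m\<close>, which no degree reaches, so the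
  first candidate is \<open>S\<close> itself.\<close>

lemma threshold_start:
  assumes "edge_inv m st"
  shows "runs w (block [Move 9 (Const 0), Move 11 (Reg 8), Move 12 (Reg 4), Move 14 (Reg 3)]) st
    (\<lambda>t st'. t \<le> 5 \<and> threshold_inv 0 st')"
proof -
  obtain r M where st: "st = (r, M)" by (cases st)
  have "captured (Suc m) = inner m" "level m (Suc m) = 0"
    unfolding captured_def level_def superlevel_top by simp_all
  moreover have "best_threshold (Suc m) (Suc m)" by (auto simp: best_threshold_def le_antisym)
  ultimately show ?thesis
    using assms unfolding st edge_inv_def threshold_inv_def layout_def by simp
qed

lemma threshold_phase:
  "threshold_inv 0 st \<Longrightarrow>
    runs w (While (Less (Const 0) (Reg 14)) threshold_body) st
      (\<lambda>t st'. t \<le> m * (20 + 1) + 1 \<and> threshold_inv m st')"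
  by (rule runs_While[where I = threshold_inv, OF _ threshold_step]) (auto simp: threshold_inv_def)

lemma output_start:
  assumes "threshold_inv m st"
  shows "runs w (block [Move 0 (Reg 4), Move 7 (Const 3)]) st
    (\<lambda>t st'. t \<le> 3 \<and> (\<exists>b. best_threshold 1 b \<and> output_inv b 0 st'))"
proof -
  obtain r M where st: "st = (r, M)" by (cases st)
  have M: "\<forall>j < 3 + 2 * m + sz. M j = inp ! j" "layout r" "best_threshold 1 (r 13)"
    "\<forall>v<n. M (deg_base + v) = (if v \<in> S then Suc m else deg m v)"
    using assms unfolding st threshold_inv_def arrays_def by simp_all
  have "{3 + 2 * m..<3 + 2 * m + sz} = (\<lambda>i. 3 + 2 * m + i) ` {..<sz}"
    by (simp add: lessThan_atLeast0 add_ac)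
  then have "M ` {3 + 2 * m..<3 + 2 * m + sz} = (\<lambda>i. M (3 + 2 * m + i)) ` {..<sz}"
    by (simp only: image_image)
  also have "\<dots> = (\<lambda>i. xs ! i) ` {..<sz}"
    using M(1) inp_set by (intro image_cong) simp_all
  also have "\<dots> = S" by (auto simp: set_conv_nth)
  finally have o: "M ` {3 + 2 * m..<3 + 2 * m + sz} = S" .
  have "3 < (2::nat) ^ w" using word_linear by linarith
  moreover have "runs w (block [Move 0 (Reg 4), Move 7 (Const 3)]) st
    (\<lambda>t st'. t \<le> 3 \<and> output_inv (r 13) 0 st')"
    using M(1,2,4) o \<open>3 < 2 ^ w\<close> unfolding st output_inv_def layout_def by simp
  ultimately show ?thesis using M(3) by (elim runs_mono) blast
qed

text \<open>Since \<open>b \<ge> 1\<close>, a vertex reaching the threshold lies on an edge, so the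
  scan of the edge list has met the whole superlevel set.\<close>

lemma output_inv_final:
  assumes "best_threshold 1 b" "output_inv b (2 * m) st"
  shows "output_set st = S \<union> superlevel m b"
proof -
  have b: "1 \<le> b" using assms(1) by (simp add: best_threshold_def)
  have "v \<in> \<Union> (edges m)" if "b \<le> deg m v" for v
  proof -
    have "0 < card {e \<in> edges m. v \<in> e \<and> e - {v} \<subseteq> S}"
      using that b unfolding deg_def cross_degree_def by linarith
    then have "{e \<in> edges m. v \<in> e \<and> e - {v} \<subseteq> S} \<noteq> {}" using card_gt_0_iff by blast
    then show ?thesis by blast
  qed
  moreover have "v < n" if "v \<in> \<Union> (edges m)" for v
    using that inp_flat_less unfolding inp_flat_set[symmetric] by blast
  ultimately have "S \<union> {v \<in> \<Union> (edges m). v \<in> S \<or> b \<le> deg m v} = S \<union> superlevel m b" by blast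
  then show ?thesis using assms(2) unfolding output_inv_def output_set_def inp_flat_set[symmetric]
    by (auto split: prod.splits)
qed

lemma output_phase:
  assumes "\<exists>b. best_threshold 1 b \<and> output_inv b 0 st"
  shows "runs w (While (Less (Reg 7) (Reg 1)) output_body) st (\<lambda>t st'. t \<le> 2 * m * (12 + 1) + 1 \<and>
    (\<exists>b. best_threshold 1 b \<and> output_set st' = S \<union> superlevel m b))"
proof -
  obtain b where b: "best_threshold 1 b" "output_inv b 0 st" using assms by blast
  then have "b \<le> Suc m" by (simp add: best_threshold_def)
  have "runs w (While (Less (Reg 7) (Reg 1)) output_body) st
      (\<lambda>t st'. t \<le> 2 * m * (12 + 1) + 1 \<and> output_inv b (2 * m) st')"
    by (rule runs_While[where I = "output_inv b", OF b(2) output_step[OF _ \<open>b \<le> Suc m\<close>]])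
      (auto simp: output_inv_def layout_def)
  then show ?thesis using b(1) output_inv_final by (elim runs_mono) blast
qed

lemma nonempty_prog_runs:
  assumes "st = ((\<lambda>_. 0)(3 := m), \<lambda>i. if i < length inp then inp ! i else 0)"
  shows "runs w nonempty_prog st (\<lambda>t st'. t \<le> 70 * m + 11 * sz + 30 \<and>
    (\<exists>b. best_threshold 1 b \<and> output_set st' = S \<union> superlevel m b))"
proof -
  let ?Q = "\<lambda>st'. \<exists>b. best_threshold 1 b \<and> output_set st' = S \<union> superlevel m b"
  \<comment> \<open>One summand per phase, in program order; the last 1 is the \<open>Skip\<close>
    closing the block. The total \<open>68 * m + 11 * sz + 28\<close> is rounded up.\<close>
  have "runs w nonempty_prog st (\<lambda>t st'. t \<le> 12 + (sz * (10 + 1) + 1 + (3 + (m * (20 + 1) + 1 +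
    (5 + (m * (20 + 1) + 1 + (3 + (2 * m * (12 + 1) + 1 + 1))))))) \<and> ?Q st')"
    unfolding nonempty_prog_def block.simps(2)
    apply (rule runs_timed_Seq, rule mark_start[OF assms])
    apply (rule runs_timed_Seq, erule mark_phase)
    apply (rule runs_timed_Seq, erule edge_start[unfolded block.simps(2)])
    apply (rule runs_timed_Seq, erule edge_phase)
    apply (rule runs_timed_Seq, erule threshold_start[unfolded block.simps(2)])
    apply (rule runs_timed_Seq, erule threshold_phase)
    apply (rule runs_timed_Seq, erule output_start[unfolded block.simps(2)])
    apply (rule runs_timed_Seq, erule output_phase)
    apply simp
    done
  then show ?thesis by (rule runs_mono) auto
qed

text \<open>Adding \<open>H - S\<close> is good enough by \<open>near_optimal_extension\<close>;
  some threshold set does at least as well, the chosen one is the best of these, and edges missing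
  from \<open>captured\<close> only raise its true density.\<close>

lemma best_threshold_density:
  assumes G: "simple_graph {..<n} (edges m)"
    and opt: "is_arg_max (sq_density (edges m)) (\<lambda>U. U \<subseteq> {..<n} \<and> U \<noteq> {}) H"
    and eps: "0 < \<epsilon>" "\<epsilon> \<le> 1 / 2"
    and hit: "real (card (S \<inter> H)) \<ge> (1 - \<epsilon>) * real (card H)"
    and miss: "real (card (S - H)) \<le> \<epsilon> * real (card H)"
    and b: "best_threshold 1 b"
  shows "(1 - 3 * sqrt \<epsilon>) * sq_density (edges m) H \<le> sq_density (edges m) (S \<union> superlevel m b)"
proof -
  have HB: "H - S \<subseteq> {..<n} - S" using opt unfolding is_arg_max_def by auto
  have cS: "card S = sz" by (rule distinct_card[OF distinct_xs])
  have deg: "deg m = cross_degree (edges m) S" by (simp add: deg_def fun_eq_iff)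
  obtain d where d: "d \<in> {1..Suc m}" and dq:
    "(real (inner m + sum (deg m) (H - S)))\<^sup>2 / real (sz + card (H - S))
      \<le> (real (captured d))\<^sup>2 / real (sz + level m d)"
    using threshold_set_maximizes_quotient[OF _ HB sz_pos, of "deg m" m "inner m"] deg_le[of m]
    unfolding captured_def level_def by auto
  have pos: "0 < real (sz + level m j)" for j
    unfolding of_nat_0_less_iff by (rule trans_less_add1[OF sz_pos])
  have "(captured d)\<^sup>2 * (sz + level m b) \<le> (captured b)\<^sup>2 * (sz + level m d)"
    using b d unfolding best_threshold_def by blast
  then have "real ((captured d)\<^sup>2 * (sz + level m b)) \<le> real ((captured b)\<^sup>2 * (sz + level m d))"
    by (rule of_nat_mono)
  then have "(real (captured d))\<^sup>2 * real (sz + level m b) \<le> (real (captured b))\<^sup>2 * real (sz + level m d)"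
    by (simp only: of_nat_mult of_nat_power)
  then have db: "(real (captured d))\<^sup>2 / real (sz + level m d) \<le> (real (captured b))\<^sup>2 / real (sz + level m b)"
    using pos[of d] pos[of b] by (simp only: pos_le_divide_eq pos_divide_le_eq times_divide_eq_left)
  have card: "card (S \<union> superlevel m b) = sz + level m b"
    unfolding level_def cS[symmetric] by (intro card_Un_disjoint) auto
  have "(1 - 3 * sqrt \<epsilon>) * sq_density (edges m) H
    \<le> (real (inner m + sum (deg m) (H - S)))\<^sup>2 / real (sz + card (H - S))"
    using near_optimal_extension[OF G opt eps xs_less hit miss] unfolding inner_def deg cS .
  also note dq
  also note db
  also have "(real (captured b))\<^sup>2 / real (sz + level m b)
    \<le> sq_density (edges m) (S \<union> superlevel m b)"
    unfolding sq_density_def card using captured_le[of b]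
    by (intro divide_right_mono power_mono) simp_all
  finally show ?thesis .
qed

lemma refine_prog_runs:
  "runs w refine_prog (initial_state inp) (\<lambda>t st'. t \<le> 70 * m + 11 * sz + 40 \<and>
    (\<exists>b. best_threshold 1 b \<and> output_set st' = S \<union> superlevel m b))"
proof -
  have cs: "operand_val w q (Const (Suc 0)) = Suc 0" "operand_val w q (Const 0) = 0" for q
    using word_linear by (simp_all add: binop_val_exact(4) del: operand_val.simps(1))
  have i1: "inp ! Suc 0 = m" "Suc 0 < length inp" using inp_header length_inp by simp_all
  define M where "M = (\<lambda>i. if i < length inp then inp ! i else 0)"
  have M1: "M (Suc 0) = m" using i1 by (simp add: M_def)
  have init: "initial_state inp = (\<lambda>_. 0, M)" by (simp add: initial_state_def M_def)
  have "runs w nonempty_prog ((\<lambda>_. 0)(3 := m), M) (\<lambda>t st'. t \<le> 70 * m + 11 * sz + 30 \<and>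
    (\<exists>b. best_threshold 1 b \<and> output_set st' = S \<union> superlevel m b))"
    by (rule nonempty_prog_runs) (simp add: M_def)
  then have run: "runs w nonempty_prog ((\<lambda>_. 0)(3 := m), M) (\<lambda>t st'. 1 + (1 + t + 1) \<le> 70 * m + 11 * sz + 40 \<and>
    (\<exists>b. best_threshold 1 b \<and> output_set st' = S \<union> superlevel m b))"
    by (rule runs_mono) auto
  then show ?thesis unfolding init refine_prog_def using m_pos
    by (simp add: M1 cs del: operand_val.simps(1))
qed

end

section \<open>Edgeless graphs, word length and the final bound\<close>

lemma refine_prog_edgeless:
  assumes "1 \<le> w"
  shows "runs w refine_prog (initial_state (input_words n [] xs))
    (\<lambda>t st'. t \<le> 10 \<and> output_set st' = {0})"
proof -
  \<comment> \<open>With \<open>w = 0\<close> the constant 1 would wrap around to 0.\<close>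
  have "(1::nat) < 2 ^ w" using assms by (metis one_less_numeral_iff one_less_power semiring_norm(76) less_eq_Suc_le One_nat_def)
  then show ?thesis using assms
    by (simp add: initial_state_def input_words_def refine_prog_def output_set_def)
qed

text \<open>\<open>floorlog 2 x\<close> is the number of binary digits of \<open>x\<close>, so
  \<open>x + 1\<close> is at most the corresponding power of two.\<close>

lemma Suc_power_le_two_power_floorlog: "(x + 1) ^ k \<le> 2 ^ (k * floorlog 2 x)"
proof -
  have "x < 2 ^ floorlog 2 x"
    by (cases "x = 0") (use floorlog_bounds[of x 2] in auto)
  then have "(x + 1) ^ k \<le> (2 ^ floorlog 2 x) ^ k" by (intro power_mono) auto
  then show ?thesis by (metis mult.commute power_mult)
qed

theorem theorem3:
  shows "\<exists>(prog :: com) (k :: nat) (time :: nat \<Rightarrow> real).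
    time \<in> O(\<lambda>m. real m) \<and>
    (\<forall>(n :: nat) (m :: nat) (E :: nat set set) (H :: nat set) (S :: nat set) (\<epsilon> :: real)
       (es :: (nat \<times> nat) list) (xs :: nat list).
       simple_graph {..<n} E \<longrightarrow> m = card E \<longrightarrow>
       is_arg_max (sq_density E) (\<lambda>U. U \<subseteq> {..<n} \<and> U \<noteq> {}) H \<longrightarrow>
       0 < \<epsilon> \<longrightarrow> \<epsilon> \<le> 1 / 2 \<longrightarrow>
       S \<subseteq> {..<n} \<longrightarrow>
       real (card (S \<inter> H)) \<ge> (1 - \<epsilon>) * real (card H) \<longrightarrow>
       real (card (S - H)) \<le> \<epsilon> * real (card H) \<longrightarrow>
       edge_list_of es E \<longrightarrow> set_list_of xs S \<longrightarrow>
       (\<exists>t s'. exec (k * floorlog 2 (n + m)) prog (initial_state (input_words n es xs)) t s' \<and>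
          real t \<le> time m \<and>
          output_set s' \<subseteq> {..<n} \<and> output_set s' \<noteq> {} \<and>
          sq_density E (output_set s') \<ge> (1 - 3 * sqrt \<epsilon>) * sq_density E H))"
proof (rule exI[of _ refine_prog], rule exI[of _ 4], rule exI[of _ "\<lambda>m. 103 * real m + 40"],
    intro conjI allI impI)
  \<comment> \<open>From \<open>m = 1\<close> on, \<open>143 = 103 + 40\<close> works as the
    constant.\<close>
  show "(\<lambda>m. 103 * real m + 40) \<in> O(\<lambda>m. real m)"
    by (rule bigoI[of _ 143]) (auto simp: eventually_at_top_linorder intro!: exI[of _ 1])
next
  fix n m :: nat and E :: "nat set set" and H S :: "nat set" and \<epsilon> :: real
    and es :: "(nat \<times> nat) list" and xs :: "nat list"
  assume G: "simple_graph {..<n} E" and m: "m = card E"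
    and opt: "is_arg_max (sq_density E) (\<lambda>U. U \<subseteq> {..<n} \<and> U \<noteq> {}) H"
    and eps: "0 < \<epsilon>" "\<epsilon> \<le> 1 / 2" and Sn: "S \<subseteq> {..<n}"
    and hit: "real (card (S \<inter> H)) \<ge> (1 - \<epsilon>) * real (card H)"
    and miss: "real (card (S - H)) \<le> \<epsilon> * real (card H)"
    and es: "edge_list_of es E" and xs: "set_list_of xs S"
  let ?w = "4 * floorlog 2 (n + m)"
  have Hn: "H \<subseteq> {..<n}" "H \<noteq> {}" using opt unfolding is_arg_max_def by auto
  then have npos: "0 < n" by auto
  have xs': "distinct xs" "set xs = S" using xs by (auto simp: set_list_of_def)
  have dist: "distinct (map (\<lambda>(u, v). {u, v}) es)" and setE: "set (map (\<lambda>(u, v). {u, v}) es) = E"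
    using es by (auto simp: edge_list_of_def)
  have len: "length es = m" using distinct_card[OF dist] unfolding setE m by simp
  have finH: "finite H" using Hn(1) by (rule finite_subset) simp
  have cH: "0 < card H" using finH Hn(2) by (simp add: card_gt_0_iff)
  \<comment> \<open>\<open>S\<close> meets the nonempty \<open>H\<close> because
    \<open>\<epsilon> < 1\<close>, which supplies the nonemptiness that the locale demands.\<close>
  have "0 < (1 - \<epsilon>) * real (card H)" using eps cH by simp
  then have "0 < real (card (S \<inter> H))" using hit by linarith
  then have S0: "S \<noteq> {}" by auto
  show "\<exists>t s'. exec ?w refine_prog (initial_state (input_words n es xs)) t s' \<and>
          real t \<le> 103 * real m + 40 \<and>
          output_set s' \<subseteq> {..<n} \<and> output_set s' \<noteq> {} \<and>
          sq_density E (output_set s') \<ge> (1 - 3 * sqrt \<epsilon>) * sq_density E H"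
  proof (cases "es = []")
    case True
    then have E: "E = {}" using setE by simp
    have "floorlog 2 (n + m) \<noteq> 0" using npos by (simp add: floorlog_eq_zero_iff)
    then have "1 \<le> ?w" by simp
    from refine_prog_edgeless[OF this, of n xs] obtain t s' where
      "exec ?w refine_prog (initial_state (input_words n es xs)) t s'" "t \<le> 10" "output_set s' = {0}"
      unfolding runs_def True by blast
    moreover have "sq_density E U = 0" for U by (simp add: sq_density_def edges_within_def E)
    ultimately show ?thesis using npos by (intro exI[of _ t] exI[of _ s']) auto
  next
    case False
    interpret refine_input n es xs ?w
    proof
      fix u v assume "(u, v) \<in> set es"
      then have "{u, v} \<in> E" unfolding setE[symmetric] by force
      then have "{u, v} \<subseteq> {..<n}" "card {u, v} = 2" using G unfolding simple_graph_def by blast+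
      then show "u < n \<and> v < n \<and> u \<noteq> v" by (cases "u = v") auto
    next
      show "(n + length es + 1) ^ 4 \<le> 2 ^ ?w"
        using Suc_power_le_two_power_floorlog[of "n + m" 4] unfolding len .
    qed (use dist xs' S0 Sn False in auto)
    have edges: "set (take (length es) (map (\<lambda>(u, v). {u, v}) es)) = E" using setE by simp
    from refine_prog_runs obtain t s' b where
      run: "exec ?w refine_prog (initial_state (input_words n es xs)) t s'"
      and t: "t \<le> 70 * length es + 11 * length xs + 40" and b: "best_threshold 1 b"
      and out: "output_set s' = set xs \<union> superlevel (length es) b"
      unfolding runs_def by blast
    have "E \<noteq> {}" using False setE by auto
    from optimal_card_le_twice_edges[OF G this opt] have "card H \<le> 2 * m" by (simp only: m)
    \<comment> \<open>The two parts of \<open>S\<close> have at most \<open>card H\<close> and half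
      of \<open>card H\<close> elements, and \<open>card H \<le> 2 * m\<close>; hence the bound
      \<open>3 * m\<close>.\<close>
    moreover have "card S = card (S \<inter> H) + card (S - H)"
      using card_Int_Diff[of S H] finite_subset[OF Sn] by simp
    moreover have "card (S \<inter> H) \<le> card H" using finH by (intro card_mono) auto
    moreover have "real (card (S - H)) \<le> 1 / 2 * real (card H)"
      using miss mult_right_mono[OF eps(2), of "real (card H)"] by linarith
    ultimately have "card S \<le> 3 * m" by linarith
    then have "length xs \<le> 3 * m" using distinct_card[OF xs'(1)] xs'(2) by simp
    \<comment> \<open>\<open>103 = 70 + 11 * 3\<close>, replacing the length of \<open>xs\<close> by
      \<open>3 * m\<close>.\<close>
    then have "real t \<le> 103 * real m + 40" using t len by linarith
    moreover have "output_set s' \<subseteq> {..<n}" "output_set s' \<noteq> {}"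
      unfolding out using xs' Sn S0 by auto
    moreover have "(1 - 3 * sqrt \<epsilon>) * sq_density E H \<le> sq_density E (output_set s')"
      unfolding out
      by (rule best_threshold_density[unfolded edges, OF G opt eps _ _ b])
        (use hit miss xs'(2) in \<open>simp_all only:\<close>)
    ultimately show ?thesis using run by blast
  qed
qed

end
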